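(* Let $E$ be an oriented vector bundle over $\mathbf R^m$ ($m\ge2$) of rank $4$, $h$ a neutral metric of $E$ and $\nabla$ a flat $h$-connection of $E$. Let $e=(e_1,e_2,e_3,e_4)$ be an ordered pseudo-orthonormal frame field of $E$ giving the orientation of $E$, and let $\omega=[\omega^i_j]$ be the connection form of $\nabla$ with respect to $e$ ($\nabla e=e\omega$). The following two conditions are equivalent: (a) the covariant derivatives of both $\Omega_{+,2}$ and $\Omega_{-,2}$ are fully light-like; (b) there are functions $f^+,f^-,g^+,g^-$ on $\mathbf R^m$ with $dg^+\neq0$ and $dg^-\neq0$ (at every point) and $\mu\in\{+,-\}$ such that $$\omega^3_1=\tfrac12(df^+-df^-),\qquad \omega^4_2=-\tfrac12(df^++df^-)$$ and either $$\omega^2_1=\tfrac{\mu}{2}\bigl(e^{\mu f^+}dg^+-e^{\mu f^-}dg^-\bigr),\qquad \omega^3_2=\tfrac12\bigl(e^{\mu f^+}dg^++e^{\mu f^-}dg^-\bigr),$$ $$\omega^4_1=\tfrac12\bigl(e^{\mu f^+}dg^+-e^{\mu f^-}dg^-\bigr),\qquad \omega^4_3=\tfrac{\mu}{2}\bigl(e^{\mu f^+}dg^++e^{\mu f^-}dg^-\bigr),$$ or $$\omega^2_1=\tfrac{\mu}{2}\bigl(e^{\mu f^+}dg^++e^{-\mu f^-}dg^-\bigr),\qquad \omega^3_2=\tfrac12\bigl(e^{\mu f^+}dg^++e^{-\mu f^-}dg^-\bigr),$$ $$\omega^4_1=\tfrac12\bigl(e^{\mu f^+}dg^+-e^{-\mu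 f^-}dg^-\bigr),\qquad \omega^4_3=\tfrac{\mu}{2}\bigl(e^{\mu f^+}dg^+-e^{-\mu f^-}dg^-\bigr).$$
   Context: Signs $\varepsilon,\mu\in\{+,-\}$ are identified with $\pm1$. A neutral metric of a rank-$4$ bundle has signature $(2,2)$; an $h$-connection satisfies $\nabla h=0$; flat means zero curvature. An ordered pseudo-orthonormal frame field $(e_1,e_2,e_3,e_4)$ has $e_1,e_2$ space-like ($h(e_i,e_i)=1$) and $e_3,e_4$ time-like ($h(e_i,e_i)=-1$). $\hat h$ and $\hat\nabla$ are the metric and connection of $\bigwedge^2E$ induced by $h$ and $\nabla$. For such a frame, $$\Omega_{\pm,1}:=\tfrac1{\sqrt2}(e_1\wedge e_2\pm e_3\wedge e_4),\ \ \Omega_{\pm,2}:=\tfrac1{\sqrt2}(e_1\wedge e_3\pm e_4\wedge e_2),\ \ \Omega_{\pm,3}:=\tfrac1{\sqrt2}(e_1\wedge e_4\pm e_2\wedge e_3).$$ $\Omega_{\varepsilon,2}$ is a section of the time-like twistor space $\{\theta\in\bigwedge^2_\varepsilon E:\hat h(\theta,\theta)=-1\}$, where $\bigwedge^2_\varepsilon E$ is the rank-$3$ subbundle of $\bigwedge^2E$ spanned by $\Omega_{-\varepsilon,1},\Omega_{\varepsilon,2},\Omega_{\varepsilon,3}$ for positively oriented frames. For a section $\Omega$ of this twistor space, its covariant derivative $\hat\nabla\Omega$ is fully light-like if at each point $p$, $\hat\nabla_v\Omega$ is light-like or zero with respect to $\hat h$ for every tangent vector $v$ at $p$, and is nonzero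 for some $v$ (so $\hat\nabla\Omega$ determines a light-like line at each point). *)

theory Defs
  imports "HOL-Analysis.Analysis"
begin

section \<open>Smooth maps and differential forms on a Euclidean space\<close>

text \<open>Only meant for open \<open>S\<close>.\<close>

primrec Ck_on :: "nat \<Rightarrow> 'x::euclidean_space set \<Rightarrow> ('x \<Rightarrow> 'y::real_normed_vector) \<Rightarrow> bool" where
  "Ck_on 0 S f \<longleftrightarrow> continuous_on S f"
| "Ck_on (Suc n) S f \<longleftrightarrow> (\<forall>x\<in>S. f differentiable (at x)) \<and>
     (\<forall>v. Ck_on n S (\<lambda>x. frechet_derivative f (at x) v))"

definition smooth_on :: "'x::euclidean_space set \<Rightarrow> ('x \<Rightarrow> 'y::real_normed_vector) \<Rightarrow> bool" where
  "smooth_on S f \<longleftrightarrow> (\<forall>n. Ck_on n S f)"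

text \<open>A differential 1-form has type \<open>'x \<Rightarrow> 'x \<Rightarrow> real\<close>: first the base point, then the tangent vector.\<close>

definition ext_d :: "('x::euclidean_space \<Rightarrow> real) \<Rightarrow> 'x \<Rightarrow> 'x \<Rightarrow> real" where
  "ext_d f p v = frechet_derivative f (at p) v"

definition lie_bracket :: "('x::euclidean_space \<Rightarrow> 'x) \<Rightarrow> ('x \<Rightarrow> 'x) \<Rightarrow> 'x \<Rightarrow> 'x" where
  "lie_bracket X Y p = frechet_derivative Y (at p) (X p) - frechet_derivative X (at p) (Y p)"


section \<open>The exterior square of a real vector space\<close>

text \<open>
  Bivectors are modelled as finite sums of decomposable bivectors \<open>u \<and> v\<close>, where \<open>u \<and> v\<close>
  is identified with the alternating form \<open>(\<alpha>, \<beta>) \<mapsto> \<alpha> u * \<beta> v - \<alpha> v * \<beta> u\<close> on the (algebraic)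
  dual space. As linear functionals separate the points of the exterior square, this is the usual
  exterior square of \<open>'v\<close>. The value \<open>0\<close> at non-linear arguments is a dummy.
\<close>

definition bivector_sum :: "('v::real_vector \<times> 'v) list \<Rightarrow> ('v \<Rightarrow> real) \<Rightarrow> ('v \<Rightarrow> real) \<Rightarrow> real" where
  "bivector_sum xs = (\<lambda>\<alpha> \<beta>. if linear \<alpha> \<and> linear \<beta>
     then (\<Sum>(u, v)\<leftarrow>xs. \<alpha> u * \<beta> v - \<alpha> v * \<beta> u) else 0)"

typedef (overloaded) 'v bivector = "range (bivector_sum :: ('v::real_vector \<times> 'v) list \<Rightarrow> _)"
  by blast

lemma bivector_sum_append:
  "bivector_sum (xs @ ys) = (\<lambda>\<alpha> \<beta>. bivector_sum xs \<alpha> \<beta> + bivector_sum ys \<alpha> \<beta>)"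
  by (auto simp: bivector_sum_def fun_eq_iff)

lemma bivector_sum_scale:
  "bivector_sum (map (\<lambda>(u, v). (c *\<^sub>R u, v)) xs) = (\<lambda>\<alpha> \<beta>. c * bivector_sum xs \<alpha> \<beta>)"
proof (intro ext)
  fix \<alpha> \<beta> :: "'a \<Rightarrow> real"
  show "bivector_sum (map (\<lambda>(u, v). (c *\<^sub>R u, v)) xs) \<alpha> \<beta> = c * bivector_sum xs \<alpha> \<beta>"
    by (induction xs) (auto simp: bivector_sum_def linear_cmul algebra_simps split: if_splits)
qed

lemma bivector_closed:
  fixes \<Theta> \<Psi> :: "'v::real_vector bivector"
  shows "(\<lambda>\<alpha> \<beta>. Rep_bivector \<Theta> \<alpha> \<beta> + Rep_bivector \<Psi> \<alpha> \<beta>)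
           \<in> range (bivector_sum :: ('v \<times> 'v) list \<Rightarrow> _)"
    and "(\<lambda>\<alpha> \<beta>. c * Rep_bivector \<Theta> \<alpha> \<beta>) \<in> range (bivector_sum :: ('v \<times> 'v) list \<Rightarrow> _)"
    and "(\<lambda>_ _. 0) \<in> range (bivector_sum :: ('v \<times> 'v) list \<Rightarrow> _)"
proof -
  obtain xs ys where xs: "Rep_bivector \<Theta> = bivector_sum xs" and ys: "Rep_bivector \<Psi> = bivector_sum ys"
    using Rep_bivector[of \<Theta>] Rep_bivector[of \<Psi>] by blast
  show "(\<lambda>\<alpha> \<beta>. Rep_bivector \<Theta> \<alpha> \<beta> + Rep_bivector \<Psi> \<alpha> \<beta>)
           \<in> range (bivector_sum :: ('v \<times> 'v) list \<Rightarrow> _)"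
    unfolding xs ys bivector_sum_append[symmetric] by blast
  show "(\<lambda>\<alpha> \<beta>. c * Rep_bivector \<Theta> \<alpha> \<beta>) \<in> range (bivector_sum :: ('v \<times> 'v) list \<Rightarrow> _)"
    unfolding xs bivector_sum_scale[symmetric] by blast
  have "(\<lambda>_ _. 0) = bivector_sum ([] :: ('v \<times> 'v) list)"
    by (auto simp: bivector_sum_def fun_eq_iff)
  then show "(\<lambda>_ _. 0) \<in> range (bivector_sum :: ('v \<times> 'v) list \<Rightarrow> _)"
    by (metis rangeI)
qed

instantiation bivector :: (real_vector) real_vector
begin

definition zero_bivector :: "'a bivector" where
  "zero_bivector = Abs_bivector (\<lambda>_ _. 0)"

definition plus_bivector :: "'a bivector \<Rightarrow> 'a bivector \<Rightarrow> 'a bivector" where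
  "plus_bivector \<Theta> \<Psi> = Abs_bivector (\<lambda>\<alpha> \<beta>. Rep_bivector \<Theta> \<alpha> \<beta> + Rep_bivector \<Psi> \<alpha> \<beta>)"

definition scaleR_bivector :: "real \<Rightarrow> 'a bivector \<Rightarrow> 'a bivector" where
  "scaleR_bivector c \<Theta> = Abs_bivector (\<lambda>\<alpha> \<beta>. c * Rep_bivector \<Theta> \<alpha> \<beta>)"

definition uminus_bivector :: "'a bivector \<Rightarrow> 'a bivector" where
  "uminus_bivector \<Theta> = (-1) *\<^sub>R \<Theta>"

definition minus_bivector :: "'a bivector \<Rightarrow> 'a bivector \<Rightarrow> 'a bivector" where
  "minus_bivector \<Theta> \<Psi> = \<Theta> + (-1) *\<^sub>R \<Psi>"

lemma Rep_bivector_zero: "Rep_bivector (0 :: 'a bivector) = (\<lambda>_ _. 0)"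
  unfolding zero_bivector_def by (rule Abs_bivector_inverse[OF bivector_closed(3)])

lemma Rep_bivector_plus:
  "Rep_bivector (\<Theta> + \<Psi> :: 'a bivector) = (\<lambda>\<alpha> \<beta>. Rep_bivector \<Theta> \<alpha> \<beta> + Rep_bivector \<Psi> \<alpha> \<beta>)"
  unfolding plus_bivector_def by (rule Abs_bivector_inverse[OF bivector_closed(1)])

lemma Rep_bivector_scaleR:
  "Rep_bivector (c *\<^sub>R \<Theta> :: 'a bivector) = (\<lambda>\<alpha> \<beta>. c * Rep_bivector \<Theta> \<alpha> \<beta>)"
  unfolding scaleR_bivector_def by (rule Abs_bivector_inverse[OF bivector_closed(2)])

instance
  by standard
    (auto simp: Rep_bivector_inject[symmetric] Rep_bivector_zero Rep_bivector_plus
      Rep_bivector_scaleR uminus_bivector_def minus_bivector_def fun_eq_iff algebra_simps)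

end

definition wedge :: "'v::real_vector \<Rightarrow> 'v \<Rightarrow> 'v bivector" (infixl \<open>\<and>\<^sub>\<Lambda>\<close> 70) where
  "u \<and>\<^sub>\<Lambda> v = Abs_bivector (bivector_sum [(u, v)])"

lemma Rep_bivector_wedge:
  "Rep_bivector (u \<and>\<^sub>\<Lambda> v) = (\<lambda>\<alpha> \<beta>. if linear \<alpha> \<and> linear \<beta> then \<alpha> u * \<beta> v - \<alpha> v * \<beta> u else 0)"
  by (simp add: wedge_def Abs_bivector_inverse) (simp add: bivector_sum_def fun_eq_iff)

text \<open>The exterior square of a subspace \<open>V\<close>, as a subspace of the exterior square of the ambient space.\<close>

definition ext_square :: "'v::real_vector set \<Rightarrow> 'v bivector set" where
  "ext_square V = span {u \<and>\<^sub>\<Lambda> v | u v. u \<in> V \<and> v \<in> V}"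


section \<open>Linear algebra of a fibre\<close>

definition is_basis :: "'v::real_vector set \<Rightarrow> ('k::finite \<Rightarrow> 'v) \<Rightarrow> bool" where
  "is_basis V b \<longleftrightarrow> inj b \<and> independent (range b) \<and> span (range b) = V"

definition bilinear_form_on :: "'v::real_vector set \<Rightarrow> ('v \<Rightarrow> 'v \<Rightarrow> real) \<Rightarrow> bool" where
  "bilinear_form_on V g \<longleftrightarrow> (\<forall>u\<in>V. \<forall>v\<in>V. \<forall>w\<in>V. \<forall>c.
     g (u + v) w = g u w + g v w \<and> g (c *\<^sub>R u) w = c * g u w \<and>
     g w (u + v) = g w u + g w v \<and> g w (c *\<^sub>R u) = c * g w u)"

text \<open>
  The index type \<open>4\<close> of ordered bases has the elements \<open>1\<close>, \<open>2\<close>, \<open>3\<close>, \<open>4\<close> (with \<open>4 = 0\<close>).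
\<close>

definition pseudo_orthonormal :: "('v \<Rightarrow> 'v \<Rightarrow> real) \<Rightarrow> (4 \<Rightarrow> 'v) \<Rightarrow> bool" where
  "pseudo_orthonormal g b \<longleftrightarrow> (\<forall>i j. g (b i) (b j) =
     (if i \<noteq> j then 0 else if i \<in> {1, 2} then 1 else -1))"

text \<open>Symmetric bilinear forms of signature (2,2) on a 4-dimensional space.\<close>

definition neutral_form_on :: "'v::real_vector set \<Rightarrow> ('v \<Rightarrow> 'v \<Rightarrow> real) \<Rightarrow> bool" where
  "neutral_form_on V g \<longleftrightarrow> bilinear_form_on V g \<and> (\<forall>u\<in>V. \<forall>v\<in>V. g u v = g v u) \<and>
     (\<exists>b. is_basis V b \<and> pseudo_orthonormal g b)"


section \<open>Vector bundles over a Euclidean space\<close>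

text \<open>
  The fibres \<open>E p\<close> are subspaces of one real vector space \<open>'v\<close>, which may be infinite-dimensional;
  this is no restriction, since any family of vector spaces embeds into its direct sum.
  The smooth structure is given by a set \<open>\<A>\<close> of local trivialisations \<open>(U, \<phi>)\<close> with smooth
  transition functions. The fibre isomorphisms \<open>\<phi> p\<close> from \<open>E p\<close> onto \<open>real ^ 'k\<close> are taken to be
  linearly extended to all of \<open>'v\<close>; only their values on \<open>E p\<close> matter.
\<close>

type_synonym ('x, 'v, 'k) trivialisations = "('x set \<times> ('x \<Rightarrow> 'v \<Rightarrow> real ^ 'k)) set"

definition vector_bundle ::
  "('x::euclidean_space \<Rightarrow> 'v::real_vector set) \<Rightarrow> ('x, 'v, 'k::finite) trivialisations \<Rightarrow> bool" where
  "vector_bundle E \<A> \<longleftrightarrow>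
     (\<forall>p. subspace (E p)) \<and>
     (\<forall>p. \<exists>(U, \<phi>)\<in>\<A>. p \<in> U) \<and>
     (\<forall>(U, \<phi>)\<in>\<A>. open U \<and> (\<forall>p\<in>U. linear (\<phi> p) \<and> bij_betw (\<phi> p) (E p) UNIV)) \<and>
     (\<forall>(U, \<phi>)\<in>\<A>. \<forall>(V, \<psi>)\<in>\<A>. \<forall>w.
        smooth_on (U \<inter> V) (\<lambda>p. \<psi> p (the_inv_into (E p) (\<phi> p) w)))"

definition sections_on :: "'x::euclidean_space set \<Rightarrow> ('x \<Rightarrow> 'v::real_vector set) \<Rightarrow>
    ('x, 'v, 'k::finite) trivialisations \<Rightarrow> ('x \<Rightarrow> 'v) set" where
  "sections_on W E \<A> = {s. (\<forall>p\<in>W. s p \<in> E p) \<and>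
     (\<forall>(U, \<phi>)\<in>\<A>. smooth_on (W \<inter> U) (\<lambda>p. \<phi> p (s p)))}"

abbreviation sections :: "('x::euclidean_space \<Rightarrow> 'v::real_vector set) \<Rightarrow>
    ('x, 'v, 'k::finite) trivialisations \<Rightarrow> ('x \<Rightarrow> 'v) set" where
  "sections \<equiv> sections_on UNIV"

text \<open>
  Smooth sections of the second exterior power of \<open>E\<close>: \<open>Rep_bivector (\<Theta> p) (\<phi>\<^sub>i p) (\<phi>\<^sub>j p)\<close> is the
  coefficient of \<open>b\<^sub>i \<and> b\<^sub>j\<close> in \<open>\<Theta> p\<close> with respect to the local frame \<open>b\<close> defined by \<open>\<phi>\<close>.
\<close>

definition bivector_sections :: "('x::euclidean_space \<Rightarrow> 'v::real_vector set) \<Rightarrow>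
    ('x, 'v, 'k::finite) trivialisations \<Rightarrow> ('x \<Rightarrow> 'v bivector) set" where
  "bivector_sections E \<A> = {\<Theta>. (\<forall>p. \<Theta> p \<in> ext_square (E p)) \<and>
     (\<forall>(U, \<phi>)\<in>\<A>. \<forall>i j.
        smooth_on U (\<lambda>p. Rep_bivector (\<Theta> p) (\<lambda>u. \<phi> p u $ i) (\<lambda>u. \<phi> p u $ j)))}"

text \<open>
  An orientation singles out, in each fibre, a class of ordered bases that are related by matrices of
  positive determinant, such that each point has a neighbourhood with a smooth frame in that class.
\<close>

definition orientation :: "('x::euclidean_space \<Rightarrow> 'v::real_vector set) \<Rightarrow>
    ('x, 'v, 'k::finite) trivialisations \<Rightarrow> ('x \<Rightarrow> ('k \<Rightarrow> 'v) set) \<Rightarrow> bool" where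
  "orientation E \<A> \<O> \<longleftrightarrow> (\<forall>p. \<exists>U b. open U \<and> p \<in> U \<and> (\<forall>i. b i \<in> sections_on U E \<A>) \<and>
     (\<forall>q\<in>U. is_basis (E q) (\<lambda>i. b i q) \<and>
        \<O> q = {c. \<exists>M :: real ^ 'k ^ 'k. det M > 0 \<and> (\<forall>j. c j = (\<Sum>i\<in>UNIV. (M $ i $ j) *\<^sub>R b i q))}))"

definition neutral_metric :: "('x::euclidean_space \<Rightarrow> 'v::real_vector set) \<Rightarrow>
    ('x, 'v, 4) trivialisations \<Rightarrow> ('x \<Rightarrow> 'v \<Rightarrow> 'v \<Rightarrow> real) \<Rightarrow> bool" where
  "neutral_metric E \<A> h \<longleftrightarrow> (\<forall>p. neutral_form_on (E p) (h p)) \<and>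
     (\<forall>s\<in>sections E \<A>. \<forall>t\<in>sections E \<A>. smooth_on UNIV (\<lambda>p. h p (s p) (t p)))"

definition pseudo_orthonormal_frame :: "('x::euclidean_space \<Rightarrow> 'v::real_vector set) \<Rightarrow>
    ('x, 'v, 4) trivialisations \<Rightarrow> ('x \<Rightarrow> 'v \<Rightarrow> 'v \<Rightarrow> real) \<Rightarrow> (4 \<Rightarrow> 'x \<Rightarrow> 'v) \<Rightarrow> bool" where
  "pseudo_orthonormal_frame E \<A> h e \<longleftrightarrow> (\<forall>i. e i \<in> sections E \<A>) \<and>
     (\<forall>p. is_basis (E p) (\<lambda>i. e i p) \<and> pseudo_orthonormal (h p) (\<lambda>i. e i p))"


section \<open>Connections\<close>

text \<open>
  A connection on a bundle with module of smooth sections \<open>\<Gamma>\<close>. Here \<open>D s p v\<close> is the covariant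
  derivative of \<open>s\<close> at \<open>p\<close> in the direction of the tangent vector \<open>v\<close>.
\<close>

definition connection :: "('x::euclidean_space \<Rightarrow> 'w::real_vector) set \<Rightarrow>
    (('x \<Rightarrow> 'w) \<Rightarrow> 'x \<Rightarrow> 'x \<Rightarrow> 'w) \<Rightarrow> bool" where
  "connection \<Gamma> D \<longleftrightarrow>
     (\<forall>s\<in>\<Gamma>. \<forall>v. (\<lambda>p. D s p v) \<in> \<Gamma>) \<and>
     (\<forall>s\<in>\<Gamma>. \<forall>p. linear (D s p)) \<and>
     (\<forall>s\<in>\<Gamma>. \<forall>t\<in>\<Gamma>. \<forall>p v. D (\<lambda>q. s q + t q) p v = D s p v + D t p v) \<and>
     (\<forall>f. smooth_on UNIV f \<longrightarrow> (\<forall>s\<in>\<Gamma>. \<forall>p v.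
        D (\<lambda>q. f q *\<^sub>R s q) p v = ext_d f p v *\<^sub>R s p + f p *\<^sub>R D s p v))"

definition metric_connection :: "('x::euclidean_space \<Rightarrow> 'v::real_vector) set \<Rightarrow>
    ('x \<Rightarrow> 'v \<Rightarrow> 'v \<Rightarrow> real) \<Rightarrow> (('x \<Rightarrow> 'v) \<Rightarrow> 'x \<Rightarrow> 'x \<Rightarrow> 'v) \<Rightarrow> bool" where
  "metric_connection \<Gamma> h D \<longleftrightarrow> connection \<Gamma> D \<and> (\<forall>s\<in>\<Gamma>. \<forall>t\<in>\<Gamma>. \<forall>p v.
     ext_d (\<lambda>q. h q (s q) (t q)) p v = h p (D s p v) (t p) + h p (s p) (D t p v))"

definition curvature :: "(('x::euclidean_space \<Rightarrow> 'v::real_vector) \<Rightarrow> 'x \<Rightarrow> 'x \<Rightarrow> 'v) \<Rightarrow>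
    ('x \<Rightarrow> 'x) \<Rightarrow> ('x \<Rightarrow> 'x) \<Rightarrow> ('x \<Rightarrow> 'v) \<Rightarrow> 'x \<Rightarrow> 'v" where
  "curvature D X Y s p = D (\<lambda>q. D s q (Y q)) p (X p) - D (\<lambda>q. D s q (X q)) p (Y p)
     - D s p (lie_bracket X Y p)"

definition flat :: "('x::euclidean_space \<Rightarrow> 'v::real_vector) set \<Rightarrow>
    (('x \<Rightarrow> 'v) \<Rightarrow> 'x \<Rightarrow> 'x \<Rightarrow> 'v) \<Rightarrow> bool" where
  "flat \<Gamma> D \<longleftrightarrow> (\<forall>X Y. smooth_on UNIV X \<longrightarrow> smooth_on UNIV Y \<longrightarrow>
     (\<forall>s\<in>\<Gamma>. \<forall>p. curvature D X Y s p = 0))"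

text \<open>The connection form in \<open>\<nabla> e = e \<omega>\<close>: upper (row) index first.\<close>

definition connection_form :: "(('x::euclidean_space \<Rightarrow> 'v::real_vector) \<Rightarrow> 'x \<Rightarrow> 'x \<Rightarrow> 'v) \<Rightarrow>
    ('k::finite \<Rightarrow> 'x \<Rightarrow> 'v) \<Rightarrow> ('k \<Rightarrow> 'k \<Rightarrow> 'x \<Rightarrow> 'x \<Rightarrow> real) \<Rightarrow> bool" where
  "connection_form D e \<omega> \<longleftrightarrow> (\<forall>j p v. D (e j) p v = (\<Sum>i\<in>UNIV. \<omega> i j p v *\<^sub>R e i p))"

text \<open>
  The metric and the connection of the second exterior power that are induced by \<open>h\<close> and \<open>D\<close>
  are characterised by their values on decomposable bivectors.
\<close>

definition induced_metric :: "('x::euclidean_space \<Rightarrow> 'v::real_vector set) \<Rightarrow>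
    ('x \<Rightarrow> 'v \<Rightarrow> 'v \<Rightarrow> real) \<Rightarrow> ('x \<Rightarrow> 'v bivector \<Rightarrow> 'v bivector \<Rightarrow> real) \<Rightarrow> bool" where
  "induced_metric E h h2 \<longleftrightarrow> (\<forall>p. bilinear_form_on (ext_square (E p)) (h2 p) \<and>
     (\<forall>u\<in>E p. \<forall>v\<in>E p. \<forall>w\<in>E p. \<forall>z\<in>E p.
        h2 p (u \<and>\<^sub>\<Lambda> v) (w \<and>\<^sub>\<Lambda> z) = h p u w * h p v z - h p u z * h p v w))"

definition induced_connection :: "('x::euclidean_space \<Rightarrow> 'v::real_vector set) \<Rightarrow>
    ('x, 'v, 'k::finite) trivialisations \<Rightarrow> (('x \<Rightarrow> 'v) \<Rightarrow> 'x \<Rightarrow> 'x \<Rightarrow> 'v) \<Rightarrow>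
    (('x \<Rightarrow> 'v bivector) \<Rightarrow> 'x \<Rightarrow> 'x \<Rightarrow> 'v bivector) \<Rightarrow> bool" where
  "induced_connection E \<A> D D2 \<longleftrightarrow> connection (bivector_sections E \<A>) D2 \<and>
     (\<forall>s\<in>sections E \<A>. \<forall>t\<in>sections E \<A>. \<forall>p v.
        D2 (\<lambda>q. s q \<and>\<^sub>\<Lambda> t q) p v = D s p v \<and>\<^sub>\<Lambda> t p + s p \<and>\<^sub>\<Lambda> D t p v)"


section \<open>Twistor spaces\<close>

text \<open>A sign is represented by a real number \<open>1\<close> or \<open>-1\<close>.\<close>

definition Omega1 :: "real \<Rightarrow> (4 \<Rightarrow> 'v::real_vector) \<Rightarrow> 'v bivector" where
  "Omega1 \<epsilon> b = (1 / sqrt 2) *\<^sub>R (b 1 \<and>\<^sub>\<Lambda> b 2 + \<epsilon> *\<^sub>R (b 3 \<and>\<^sub>\<Lambda> b 4))"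

definition Omega2 :: "real \<Rightarrow> (4 \<Rightarrow> 'v::real_vector) \<Rightarrow> 'v bivector" where
  "Omega2 \<epsilon> b = (1 / sqrt 2) *\<^sub>R (b 1 \<and>\<^sub>\<Lambda> b 3 + \<epsilon> *\<^sub>R (b 4 \<and>\<^sub>\<Lambda> b 2))"

definition Omega3 :: "real \<Rightarrow> (4 \<Rightarrow> 'v::real_vector) \<Rightarrow> 'v bivector" where
  "Omega3 \<epsilon> b = (1 / sqrt 2) *\<^sub>R (b 1 \<and>\<^sub>\<Lambda> b 4 + \<epsilon> *\<^sub>R (b 2 \<and>\<^sub>\<Lambda> b 3))"

text \<open>
  For \<open>B\<close> the set of positively oriented ordered bases of a fibre, all positively oriented
  pseudo-orthonormal bases give the same span.
\<close>

definition half_ext_square ::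
  "real \<Rightarrow> ('v::real_vector \<Rightarrow> 'v \<Rightarrow> real) \<Rightarrow> (4 \<Rightarrow> 'v) set \<Rightarrow> 'v bivector set" where
  "half_ext_square \<epsilon> g B =
     span (\<Union>b\<in>{b \<in> B. pseudo_orthonormal g b}. {Omega1 (-\<epsilon>) b, Omega2 \<epsilon> b, Omega3 \<epsilon> b})"

definition timelike_twistor_space :: "real \<Rightarrow> ('x \<Rightarrow> 'v::real_vector \<Rightarrow> 'v \<Rightarrow> real) \<Rightarrow>
    ('x \<Rightarrow> (4 \<Rightarrow> 'v) set) \<Rightarrow> ('x \<Rightarrow> 'v bivector \<Rightarrow> 'v bivector \<Rightarrow> real) \<Rightarrow> 'x \<Rightarrow> 'v bivector set" where
  "timelike_twistor_space \<epsilon> h \<O> h2 p = {\<theta> \<in> half_ext_square \<epsilon> (h p) (\<O> p). h2 p \<theta> \<theta> = -1}"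

definition timelike_twistor_sections :: "('x::euclidean_space \<Rightarrow> 'v::real_vector set) \<Rightarrow>
    ('x, 'v, 4) trivialisations \<Rightarrow> real \<Rightarrow> ('x \<Rightarrow> 'v \<Rightarrow> 'v \<Rightarrow> real) \<Rightarrow> ('x \<Rightarrow> (4 \<Rightarrow> 'v) set) \<Rightarrow>
    ('x \<Rightarrow> 'v bivector \<Rightarrow> 'v bivector \<Rightarrow> real) \<Rightarrow> ('x \<Rightarrow> 'v bivector) set" where
  "timelike_twistor_sections E \<A> \<epsilon> h \<O> h2 =
     {\<Omega> \<in> bivector_sections E \<A>. \<forall>p. \<Omega> p \<in> timelike_twistor_space \<epsilon> h \<O> h2 p}"

definition light_like :: "('w::zero \<Rightarrow> 'w \<Rightarrow> real) \<Rightarrow> 'w \<Rightarrow> bool" where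
  "light_like g w \<longleftrightarrow> w \<noteq> 0 \<and> g w w = 0"

definition fully_light_like_twistor_section :: "('x::euclidean_space \<Rightarrow> 'v::real_vector set) \<Rightarrow>
    ('x, 'v, 4) trivialisations \<Rightarrow> real \<Rightarrow> ('x \<Rightarrow> 'v \<Rightarrow> 'v \<Rightarrow> real) \<Rightarrow> ('x \<Rightarrow> (4 \<Rightarrow> 'v) set) \<Rightarrow>
    ('x \<Rightarrow> 'v bivector \<Rightarrow> 'v bivector \<Rightarrow> real) \<Rightarrow>
    (('x \<Rightarrow> 'v bivector) \<Rightarrow> 'x \<Rightarrow> 'x \<Rightarrow> 'v bivector) \<Rightarrow> ('x \<Rightarrow> 'v bivector) \<Rightarrow> bool" where
  "fully_light_like_twistor_section E \<A> \<epsilon> h \<O> h2 D2 \<Omega> \<longleftrightarrow>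
     \<Omega> \<in> timelike_twistor_sections E \<A> \<epsilon> h \<O> h2 \<and>
     (\<forall>p. (\<forall>v. light_like (h2 p) (D2 \<Omega> p v) \<or> D2 \<Omega> p v = 0) \<and> (\<exists>v. D2 \<Omega> p v \<noteq> 0))"

end

theory Submission
  imports Defs
begin

text \<open>
  The derivative of \<open>\<Omega>\<^bsub>\<epsilon>,2\<^esub>\<close> is \<open>\<theta>\<^sub>1 \<Omega>\<^bsub>-\<epsilon>,1\<^esub> + \<theta>\<^sub>2 \<Omega>\<^bsub>\<epsilon>,3\<^esub>\<close> with \<open>\<theta>\<^sub>1 = \<omega>\<^sup>3\<^sub>2 + \<epsilon> \<omega>\<^sup>4\<^sub>1\<close> and
  \<open>\<theta>\<^sub>2 = \<omega>\<^sup>4\<^sub>3 + \<epsilon> \<omega>\<^sup>2\<^sub>1\<close>, and its square norm is \<open>\<theta>\<^sub>1\<^sup>2 - \<theta>\<^sub>2\<^sup>2\<close>. Hence it is fully light-like iff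
  \<open>\<theta>\<^sub>1\<close> has no zeros and \<open>\<theta>\<^sub>2 = \<mu> \<theta>\<^sub>1\<close> for a sign \<open>\<mu>\<close>, which is constant by connectedness.
  With \<open>\<phi> = \<epsilon> \<omega>\<^sup>3\<^sub>1 - \<omega>\<^sup>4\<^sub>2\<close>, flatness gives \<open>d\<phi> = - \<theta>\<^sub>1 \<and> \<theta>\<^sub>2\<close> and \<open>d\<theta>\<^sub>1 = \<phi> \<and> \<theta>\<^sub>2\<close>. In the
  light-like case \<open>\<phi>\<close> is therefore closed, so \<open>\<phi> = df\<close> by the Poincare lemma; then
  \<open>exp (- \<mu> f) \<theta>\<^sub>1\<close> is closed as well, hence equal to some \<open>dg\<close>. The two alternatives of the theorem
  are the cases of equal and of opposite signs \<open>\<mu>\<close> for \<open>\<epsilon> = 1\<close> and \<open>\<epsilon> = -1\<close>.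
\<close>

section \<open>Smooth functions and closed 1-forms\<close>

lemma Ck_on_cong:
  assumes "open S" "\<And>x. x \<in> S \<Longrightarrow> f x = g x" "Ck_on n S f"
  shows "Ck_on n S g"
  using assms(2,3)
proof (induction n arbitrary: f g)
  case 0
  then show ?case by (simp cong: continuous_on_cong)
next
  case (Suc n)
  \<comment> \<open>Since \<open>S\<close> is open, \<open>f\<close> and \<open>g\<close> agree near
    \<open>x\<close>, so the derivative of \<open>f\<close> also serves for
    \<open>g\<close>.\<close>
  have d: "(g has_derivative frechet_derivative f (at x)) (at x)" if "x \<in> S" for x
  proof (rule has_derivative_transform_within_open)
    show "(f has_derivative frechet_derivative f (at x)) (at x)"
      using Suc.prems(2) that by (simp add: frechet_derivative_works[symmetric])
  qed (use assms(1) that Suc.prems(1) in auto)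
  have "Ck_on n S (\<lambda>x. frechet_derivative g (at x) v)" for v
  proof (rule Suc.IH)
    show "frechet_derivative f (at x) v = frechet_derivative g (at x) v" if "x \<in> S" for x
      using frechet_derivative_at[OF d[OF that]] by simp
    show "Ck_on n S (\<lambda>x. frechet_derivative f (at x) v)"
      using Suc.prems(2) by simp
  qed
  then show ?case
    using d by (auto simp: differentiable_def)
qed

text \<open>Frees the induction step from the chosen \<open>frechet_derivative\<close>: any explicit
  formula for the derivative will do, by uniqueness of derivatives.\<close>

lemma Ck_on_SucI:
  assumes "open S" "\<And>x. x \<in> S \<Longrightarrow> (f has_derivative f' x) (at x)"
    and "\<And>v. Ck_on n S (\<lambda>x. f' x v)"
  shows "Ck_on (Suc n) S f"
proof -
  have "Ck_on n S (\<lambda>x. frechet_derivative f (at x) v)" for v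
    using assms(3)[of v]
    by (rule Ck_on_cong[OF assms(1), rotated]) (use assms(2) frechet_derivative_at in metis)
  then show ?thesis
    using assms(2) by (auto simp: differentiable_def)
qed

lemma Ck_on_SucD: "Ck_on (Suc n) S f \<Longrightarrow> Ck_on n S f"
proof (induction n arbitrary: f)
  case 0
  then show ?case
    by (auto intro!: continuous_at_imp_continuous_on differentiable_imp_continuous_within)
qed auto

lemma Ck_on_has_derivative:
  assumes "Ck_on (Suc n) S f" "x \<in> S"
  shows "(f has_derivative frechet_derivative f (at x)) (at x)"
  using assms by (simp add: frechet_derivative_works[symmetric])

lemma Ck_on_const [simp]: "open S \<Longrightarrow> Ck_on n S (\<lambda>x. c)"
  by (induction n arbitrary: c) auto

lemma Ck_on_bounded_linear:
  assumes "open S" "bounded_linear L" "Ck_on n S f"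
  shows "Ck_on n S (\<lambda>x. L (f x))"
  using assms(3)
proof (induction n arbitrary: f)
  case 0
  then show ?case
    using bounded_linear.continuous_on[OF assms(2)] by simp
next
  case (Suc n)
  have "Ck_on n S (\<lambda>x. L (frechet_derivative f (at x) v))" for v
    using Suc by simp
  with bounded_linear.has_derivative[OF assms(2) Ck_on_has_derivative[OF Suc.prems]] show ?case
    by (rule Ck_on_SucI[OF assms(1)])
qed

lemma Ck_on_add:
  assumes "open S" "Ck_on n S f" "Ck_on n S g"
  shows "Ck_on n S (\<lambda>x. f x + g x)"
  using assms(2,3)
proof (induction n arbitrary: f g)
  case 0
  then show ?case by (simp add: continuous_on_add)
next
  case (Suc n)
  have "Ck_on n S (\<lambda>x. frechet_derivative f (at x) v + frechet_derivative g (at x) v)" for v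
    using Suc by simp
  with has_derivative_add[OF Suc.prems[THEN Ck_on_has_derivative]] show ?case
    by (rule Ck_on_SucI[OF assms(1)])
qed

lemma Ck_on_mult:
  fixes f g :: "'x::euclidean_space \<Rightarrow> real"
  assumes "open S" "Ck_on n S f" "Ck_on n S g"
  shows "Ck_on n S (\<lambda>x. f x * g x)"
  using assms(2,3)
proof (induction n arbitrary: f g)
  case 0
  then show ?case by (simp add: continuous_on_mult)
next
  case (Suc n)
  have "Ck_on n S (\<lambda>x. f x * frechet_derivative g (at x) v + frechet_derivative f (at x) v * g x)" for v
    using Suc.prems by (intro Ck_on_add[OF assms(1)] Suc.IH) (auto intro: Ck_on_SucD)
  with has_derivative_mult[OF Suc.prems[THEN Ck_on_has_derivative]] show ?case
    by (rule Ck_on_SucI[OF assms(1)])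
qed

lemma Ck_on_exp:
  fixes f :: "'x::euclidean_space \<Rightarrow> real"
  assumes "open S" "Ck_on n S f"
  shows "Ck_on n S (\<lambda>x. exp (f x))"
  using assms(2)
proof (induction n)
  case 0
  then show ?case by (simp add: continuous_on_exp)
next
  case (Suc n)
  have "Ck_on n S (\<lambda>x. exp (f x) * frechet_derivative f (at x) v)" for v
    using Suc Ck_on_SucD by (intro Ck_on_mult[OF assms(1)]) auto
  moreover have "((\<lambda>x. exp (f x)) has_derivative (\<lambda>v. exp (f x) * frechet_derivative f (at x) v)) (at x)"
    if "x \<in> S" for x
    using Ck_on_has_derivative[OF Suc.prems that] by (auto intro!: derivative_eq_intros)
  ultimately show ?case
    by (intro Ck_on_SucI[OF assms(1)])
qed

lemma smooth_on_cong:
  assumes "open S" "\<And>x. x \<in> S \<Longrightarrow> f x = g x"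
  shows "smooth_on S f \<longleftrightarrow> smooth_on S g"
  unfolding smooth_on_def using Ck_on_cong[OF assms(1)] assms(2) by metis

context
  fixes S :: "'x::euclidean_space set"
  assumes S: "open S"
begin

lemma smooth_on_const: "smooth_on S (\<lambda>x. c)"
  using S by (simp add: smooth_on_def)

lemma smooth_on_bounded_linear:
  "bounded_linear L \<Longrightarrow> smooth_on S f \<Longrightarrow> smooth_on S (\<lambda>x. L (f x))"
  using S by (simp add: smooth_on_def Ck_on_bounded_linear)

lemma smooth_on_add: "smooth_on S f \<Longrightarrow> smooth_on S g \<Longrightarrow> smooth_on S (\<lambda>x. f x + g x)"
  using S by (simp add: smooth_on_def Ck_on_add)

lemma smooth_on_mult:
  fixes f g :: "'x \<Rightarrow> real"
  shows "smooth_on S f \<Longrightarrow> smooth_on S g \<Longrightarrow> smooth_on S (\<lambda>x. f x * g x)"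
  using S by (simp add: smooth_on_def Ck_on_mult)

lemma smooth_on_diff:
  fixes f g :: "'x \<Rightarrow> real"
  assumes "smooth_on S f" "smooth_on S g"
  shows "smooth_on S (\<lambda>x. f x - g x)"
  using smooth_on_add[OF assms(1) smooth_on_mult[OF smooth_on_const[of "-1"] assms(2)]] by simp

lemma smooth_on_exp:
  fixes f :: "'x \<Rightarrow> real"
  shows "smooth_on S f \<Longrightarrow> smooth_on S (\<lambda>x. exp (f x))"
  using S by (simp add: smooth_on_def Ck_on_exp)

lemma smooth_on_continuous: "smooth_on S f \<Longrightarrow> continuous_on S f"
  unfolding smooth_on_def using Ck_on.simps(1) by blast

lemma smooth_on_frechet_derivative:
  "smooth_on S f \<Longrightarrow> smooth_on S (\<lambda>x. frechet_derivative f (at x) v)"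
  unfolding smooth_on_def using Ck_on.simps(2) by blast

lemma smooth_on_has_derivative:
  "smooth_on S f \<Longrightarrow> x \<in> S \<Longrightarrow> (f has_derivative frechet_derivative f (at x)) (at x)"
  unfolding smooth_on_def using Ck_on_has_derivative by blast

text \<open>Bootstrapping: a derivative of class C^n in every direction makes \<open>f\<close> of
  class C^(n+1). A primitive of a smooth form is thus smooth, without differentiating its integral
  formula repeatedly.\<close>

lemma smooth_onI_has_derivative:
  assumes "\<And>x. x \<in> S \<Longrightarrow> (f has_derivative f' x) (at x)" "\<And>v. smooth_on S (\<lambda>x. f' x v)"
  shows "smooth_on S f"
proof -
  have "Ck_on (Suc n) S f" for n
    using assms S by (intro Ck_on_SucI) (auto simp: smooth_on_def)
  then show ?thesis
    unfolding smooth_on_def using Ck_on_SucD by blast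
qed

end

section \<open>Exterior derivatives of functions and the Poincare lemma\<close>

lemma ext_d_eqI: "(f has_derivative f') (at p) \<Longrightarrow> ext_d f p = f'"
  unfolding ext_d_def by (rule ext) (metis frechet_derivative_at)

lemma ext_d_has_derivative:
  "smooth_on UNIV f \<Longrightarrow> (f has_derivative ext_d f p) (at p)"
  using smooth_on_has_derivative[of UNIV f p] unfolding ext_d_def by simp

text \<open>The primitive integrates the form along the segment from the origin. Closedness is
  tested on constant fields \<open>u\<close>, \<open>v\<close>. It turns the derivative under the
  integral into a total derivative in \<open>t\<close>.\<close>

lemma poincare_lemma:
  fixes \<alpha> :: "'x::euclidean_space \<Rightarrow> 'x \<Rightarrow> real"
  assumes lin: "\<And>p. linear (\<alpha> p)"
    and smooth: "\<And>v. smooth_on UNIV (\<lambda>p. \<alpha> p v)"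
    and closed: "\<And>p u v. ext_d (\<lambda>q. \<alpha> q v) p u = ext_d (\<lambda>q. \<alpha> q u) p v"
  obtains f where "smooth_on UNIV f" "\<And>p. ext_d f p = \<alpha> p"
proof -
  define f where "f x = integral (cbox 0 1) (\<lambda>t::real. \<alpha> (t *\<^sub>R x) x)" for x
  define A where "A i = (\<lambda>p. ext_d (\<lambda>q. \<alpha> q i) p)" for i
  have A: "((\<lambda>q. \<alpha> q i) has_derivative A i p) (at p)" for i p
    unfolding A_def by (rule ext_d_has_derivative[OF smooth])
  have Alin: "linear (A i p)" for i p
    using A has_derivative_linear by blast
  \<comment> \<open>Coordinates in the vector slot separate the two occurrences of \<open>x\<close>
    in the integrand of \<open>f\<close>, so that the product rule applies.\<close>
  have exp: "\<alpha> p v = (\<Sum>i\<in>Basis. (v \<bullet> i) * \<alpha> p i)" for p v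
    by (subst euclidean_representation[of v, symmetric])
      (simp only: linear_sum[OF lin] linear_cmul[OF lin] real_scaleR_def)
  have contA: "continuous_on UNIV (\<lambda>p. A i p v)" for i v
    unfolding A_def ext_d_def
    by (intro smooth_on_continuous smooth_on_frechet_derivative smooth) auto
  have conta: "continuous_on UNIV (\<lambda>p. \<alpha> p v)" for v
    by (intro smooth_on_continuous smooth) auto
  \<comment> \<open>The derivative of the integrand in \<open>x\<close>: the first term comes from
    the vector slot, the sum from the base point.\<close>
  define F where "F x t v = \<alpha> (t *\<^sub>R x) v + (\<Sum>i\<in>Basis. (x \<bullet> i) * A i (t *\<^sub>R x) (t *\<^sub>R v))"
    for x v :: 'x and t :: real
  have Fder: "((\<lambda>x. \<alpha> (t *\<^sub>R x) x) has_derivative F x t) (at x)" for x t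
  proof -
    have "((\<lambda>x. \<alpha> (t *\<^sub>R x) i) has_derivative (\<lambda>v. A i (t *\<^sub>R x) (t *\<^sub>R v))) (at x)" for i
      by (rule has_derivative_compose[of "\<lambda>x. t *\<^sub>R x" _ _ _ "\<lambda>q. \<alpha> q i", OF _ A])
        (auto intro!: derivative_eq_intros)
    then have "((\<lambda>x. \<Sum>i\<in>Basis. (x \<bullet> i) * \<alpha> (t *\<^sub>R x) i) has_derivative
      (\<lambda>v. \<Sum>i\<in>Basis. (x \<bullet> i) * A i (t *\<^sub>R x) (t *\<^sub>R v) + (v \<bullet> i) * \<alpha> (t *\<^sub>R x) i)) (at x)"
      by (intro has_derivative_sum has_derivative_mult) (auto intro!: derivative_eq_intros)
    then show ?thesis
      unfolding F_def by (subst (1 2) exp) (simp add: sum.distrib add.commute)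
  qed
  have Fbl: "bounded_linear (F x t)" for x t
    using Fder has_derivative_bounded_linear by blast
  have FBlin: "blinfun_apply (Blinfun (F x t)) = F x t" for x t
    by (rule bounded_linear_Blinfun_apply[OF Fbl])
  \<comment> \<open>The Leibniz rule asks for continuity in operator norm; in finite dimension this
    is continuity on each basis vector.\<close>
  have Fcont: "continuous_on UNIV (\<lambda>(x, t). Blinfun (F x t))"
  proof (rule continuous_on_blinfun_componentwise)
    fix j :: 'x
    have "continuous_on UNIV (\<lambda>z :: 'x \<times> real. \<alpha> (snd z *\<^sub>R fst z) j)"
      by (rule continuous_on_compose2[OF conta]) (auto intro!: continuous_intros)
    moreover have "continuous_on UNIV (\<lambda>z :: 'x \<times> real. A i (snd z *\<^sub>R fst z) j)" for i
      by (rule continuous_on_compose2[OF contA]) (auto intro!: continuous_intros)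
    ultimately show "continuous_on UNIV (\<lambda>x. blinfun_apply (case x of (x, t) \<Rightarrow> Blinfun (F x t)) j)"
      unfolding case_prod_beta FBlin unfolding F_def linear_cmul[OF Alin] real_scaleR_def
      by (auto intro!: continuous_intros)
  qed
  have fder: "(f has_derivative integral (cbox 0 1) (\<lambda>t. Blinfun (F x t))) (at x)" for x
  proof -
    have "((\<lambda>x. integral (cbox 0 1) (\<lambda>t. \<alpha> (t *\<^sub>R x) x)) has_derivative
      integral (cbox 0 1) (\<lambda>t. Blinfun (F x t))) (at x within UNIV)"
    proof (rule leibniz_rule)
      show "((\<lambda>x. \<alpha> (t *\<^sub>R x) x) has_derivative blinfun_apply (Blinfun (F x t))) (at x)" for x t
        using Fder FBlin by simp
      show "(\<lambda>t. \<alpha> (t *\<^sub>R x) x) integrable_on cbox 0 1" for x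
        by (rule integrable_continuous)
          (rule continuous_on_compose2[OF conta], auto intro!: continuous_intros)
      show "continuous_on (UNIV \<times> cbox 0 1) (\<lambda>(x, t). Blinfun (F x t))"
        using Fcont continuous_on_subset by blast
    qed auto
    then show ?thesis by (simp add: f_def[abs_def])
  qed
  \<comment> \<open>Evaluation at \<open>v\<close> is bounded linear and commutes with the integral,
    which leaves a scalar integral for the fundamental theorem of calculus.\<close>
  have val: "blinfun_apply (integral (cbox 0 1) (\<lambda>t. Blinfun (F x t))) v = \<alpha> x v" for x v
  proof -
    have "continuous_on (cbox 0 1) (\<lambda>t::real. case (x, t) of (x, t) \<Rightarrow> Blinfun (F x t))"
      by (rule continuous_on_compose2[OF Fcont]) (auto intro!: continuous_intros)
    then have "(\<lambda>t. Blinfun (F x t)) integrable_on (cbox 0 1)"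
      by (intro integrable_continuous) simp
    then have "((\<lambda>t. F x t v) has_integral
        blinfun_apply (integral (cbox 0 1) (\<lambda>t. Blinfun (F x t))) v) (cbox 0 1)"
      using has_integral_linear[OF integrable_integral blinfun.bounded_linear_left,
          of "\<lambda>t. Blinfun (F x t)" "cbox 0 1" v]
      by (simp add: o_def FBlin)
    moreover have "((\<lambda>t. F x t v) has_integral (1 *\<^sub>R \<alpha> (1 *\<^sub>R x) v - 0 *\<^sub>R \<alpha> (0 *\<^sub>R x) v)) {0..1}"
    proof (rule fundamental_theorem_of_calculus)
      fix t :: real
      \<comment> \<open>Closedness replaces \<open>A i _ v\<close> by \<open>A v _ i\<close>; the
        sum then collapses to the derivative in the direction \<open>x\<close>, and the right-hand
        side is the derivative of \<open>t * \<alpha> (t *\<^sub>R x) v\<close> in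
        \<open>t\<close>.\<close>
      have e: "F x t v = t * A v (t *\<^sub>R x) x + \<alpha> (t *\<^sub>R x) v"
      proof -
        have "(\<Sum>i\<in>Basis. (x \<bullet> i) * A i (t *\<^sub>R x) (t *\<^sub>R v))
            = t * (\<Sum>i\<in>Basis. (x \<bullet> i) * A v (t *\<^sub>R x) i)"
          unfolding linear_cmul[OF Alin] real_scaleR_def sum_distrib_left
          by (intro sum.cong) (auto simp: A_def closed[of v])
        also have "(\<Sum>i\<in>Basis. (x \<bullet> i) * A v (t *\<^sub>R x) i) = A v (t *\<^sub>R x) x"
          by (subst (4) euclidean_representation[of x, symmetric])
            (simp only: linear_sum[OF Alin] linear_cmul[OF Alin] real_scaleR_def)
        finally show ?thesis
          by (simp add: F_def)
      qed
      have "((\<lambda>t. \<alpha> (t *\<^sub>R x) v) has_derivative (\<lambda>s. A v (t *\<^sub>R x) (s *\<^sub>R x))) (at t)"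
        by (rule has_derivative_compose[of "\<lambda>t. t *\<^sub>R x" _ _ _ "\<lambda>q. \<alpha> q v", OF _ A])
          (auto intro!: derivative_eq_intros)
      then have "((\<lambda>t. \<alpha> (t *\<^sub>R x) v) has_real_derivative A v (t *\<^sub>R x) x) (at t)"
        unfolding linear_cmul[OF Alin] has_field_derivative_def
        by (simp add: mult.commute[of _ "A v (t *\<^sub>R x) x"])
      then have "((\<lambda>t. t *\<^sub>R \<alpha> (t *\<^sub>R x) v) has_real_derivative F x t v) (at t)"
        unfolding e by (auto intro!: derivative_eq_intros)
      then show "((\<lambda>t. t *\<^sub>R \<alpha> (t *\<^sub>R x) v) has_vector_derivative F x t v) (at t within {0..1})"
        by (metis has_real_derivative_iff_has_vector_derivative has_vector_derivative_at_within)
    qed simp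
    then have "((\<lambda>t. F x t v) has_integral \<alpha> x v) (cbox 0 1)"
      by simp
    ultimately show ?thesis
      by (rule has_integral_unique)
  qed
  then have der: "(f has_derivative \<alpha> x) (at x)" for x
    using fder[of x] by (simp only: val[of x, THEN ext])
  show ?thesis
  proof (rule that)
    show "smooth_on UNIV f"
      by (rule smooth_onI_has_derivative[OF _ der smooth]) simp
    show "ext_d f p = \<alpha> p" for p
      by (rule ext_d_eqI[OF der])
  qed
qed

section \<open>Rules for exterior derivatives, and integration of the light-like structure
  equations\<close>

lemma ext_d_const: "ext_d (\<lambda>_. c) p v = 0"
  by (simp add: ext_d_def)

lemma ext_d_add:
  assumes "smooth_on UNIV f" "smooth_on UNIV g"
  shows "ext_d (\<lambda>q. f q + g q) p v = ext_d f p v + ext_d g p v"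
  using ext_d_eqI[OF has_derivative_add[OF assms[THEN ext_d_has_derivative]]] by simp

lemma ext_d_cmult:
  fixes c :: real
  assumes "smooth_on UNIV f"
  shows "ext_d (\<lambda>q. c * f q) p v = c * ext_d f p v"
  using ext_d_eqI[OF has_derivative_mult_right[OF assms[THEN ext_d_has_derivative]]] by simp

lemma ext_d_mult:
  assumes "smooth_on UNIV f" "smooth_on UNIV g"
  shows "ext_d (\<lambda>q. f q * g q) p v = f p * ext_d g p v + ext_d f p v * g p"
  using ext_d_eqI[OF has_derivative_mult[OF assms[THEN ext_d_has_derivative]]] by simp

lemma ext_d_exp:
  assumes "smooth_on UNIV f"
  shows "ext_d (\<lambda>q. exp (f q)) p v = exp (f p) * ext_d f p v"
proof -
  have "((\<lambda>q. exp (f q)) has_derivative (\<lambda>v. exp (f p) * ext_d f p v)) (at p)"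
    using ext_d_has_derivative[OF assms] by (auto intro!: derivative_eq_intros)
  then show ?thesis by (simp add: ext_d_eqI)
qed

text \<open>At each point one of the two linear forms \<open>\<theta>\<^sub>1 \<mp> \<theta>\<^sub>2\<close> vanishes, since their product does. Both
  vanishing loci are closed and they are disjoint, so by connectedness one of them is everything.\<close>

lemma square_eq_imp_constant_sign:
  fixes \<theta>\<^sub>1 \<theta>\<^sub>2 :: "'x::euclidean_space \<Rightarrow> 'x \<Rightarrow> real"
  assumes lin: "\<And>p. linear (\<theta>\<^sub>1 p)" "\<And>p. linear (\<theta>\<^sub>2 p)"
    and cont: "\<And>v. continuous_on UNIV (\<lambda>p. \<theta>\<^sub>1 p v)" "\<And>v. continuous_on UNIV (\<lambda>p. \<theta>\<^sub>2 p v)"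
    and sq: "\<And>p v. (\<theta>\<^sub>1 p v)\<^sup>2 = (\<theta>\<^sub>2 p v)\<^sup>2"
    and nz: "\<And>p. \<exists>v. \<theta>\<^sub>1 p v \<noteq> 0"
  obtains \<mu> where "\<mu> \<in> {1, -1}" "\<And>p v. \<theta>\<^sub>2 p v = \<mu> * \<theta>\<^sub>1 p v"
proof -
  define A where "A c = {p. \<forall>v. \<theta>\<^sub>2 p v = c * \<theta>\<^sub>1 p v}" for c :: real
  have "closed (A c)" for c
    unfolding A_def by (intro closed_Collect_all closed_Collect_eq continuous_intros cont)
  moreover have "A 1 \<inter> A (-1) = {}"
    using nz by (fastforce simp: A_def)
  moreover have "A 1 \<union> A (-1) = UNIV"
  proof -
    have "p \<in> A 1 \<union> A (-1)" for p
    proof (rule ccontr)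
      assume "\<not> ?thesis"
      then obtain u v where u: "\<theta>\<^sub>2 p u \<noteq> \<theta>\<^sub>1 p u" and v: "\<theta>\<^sub>2 p v \<noteq> - \<theta>\<^sub>1 p v"
        by (auto simp: A_def)
      have "\<theta>\<^sub>2 p u = - \<theta>\<^sub>1 p u" "\<theta>\<^sub>2 p v = \<theta>\<^sub>1 p v"
        using sq[of p u] sq[of p v] u v by (auto simp: power2_eq_iff)
      \<comment> \<open>With a and b the values of \<open>\<theta>\<^sub>1 p\<close> at
        \<open>u\<close> and \<open>v\<close>, the squares at \<open>u + v\<close> are those of a +
        b and b - a. Their equality forces a = 0 or b = 0, against the choice of \<open>u\<close> or
        of \<open>v\<close>.\<close>
      moreover have "\<theta>\<^sub>1 p (u + v) = \<theta>\<^sub>1 p u + \<theta>\<^sub>1 p v" "\<theta>\<^sub>2 p (u + v) = \<theta>\<^sub>2 p u + \<theta>\<^sub>2 p v"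
        by (simp_all add: linear_add lin)
      ultimately show False
        using sq[of p "u + v"] u v by (auto simp: power2_eq_iff)
    qed
    then show ?thesis by auto
  qed
  moreover have "connected (UNIV :: 'x set)"
    by (rule connected_UNIV)
  ultimately have "A 1 = UNIV \<or> A (-1) = UNIV"
    unfolding connected_closed by (metis Int_UNIV_right Un_empty_left sup_bot.right_neutral
        subset_refl UNIV_I Int_empty_right inf.commute)
  then show ?thesis
    using that[of 1] that[of "-1"] by (auto simp: A_def)
qed

text \<open>With proportional forms the wedge of \<open>\<theta>\<^sub>1\<close> and
  \<open>\<theta>\<^sub>2\<close> vanishes, so \<open>\<phi>\<close> is closed; the second equation
  becomes a linear one for \<open>\<theta>\<^sub>1\<close>, solved by an integrating factor.\<close>

lemma closed_form_potentials:
  fixes \<theta>\<^sub>1 \<theta>\<^sub>2 \<phi> :: "'x::euclidean_space \<Rightarrow> 'x \<Rightarrow> real"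
  assumes lin: "\<And>p. linear (\<theta>\<^sub>1 p)" "\<And>p. linear (\<phi> p)"
    and smooth: "\<And>v. smooth_on UNIV (\<lambda>p. \<theta>\<^sub>1 p v)" "\<And>v. smooth_on UNIV (\<lambda>p. \<phi> p v)"
    and d\<phi>: "\<And>p u v. ext_d (\<lambda>q. \<phi> q v) p u - ext_d (\<lambda>q. \<phi> q u) p v
               = - (\<theta>\<^sub>1 p u * \<theta>\<^sub>2 p v - \<theta>\<^sub>1 p v * \<theta>\<^sub>2 p u)"
    and d\<theta>\<^sub>1: "\<And>p u v. ext_d (\<lambda>q. \<theta>\<^sub>1 q v) p u - ext_d (\<lambda>q. \<theta>\<^sub>1 q u) p v
               = \<phi> p u * \<theta>\<^sub>2 p v - \<phi> p v * \<theta>\<^sub>2 p u"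
    and \<theta>\<^sub>2: "\<And>p v. \<theta>\<^sub>2 p v = \<mu> * \<theta>\<^sub>1 p v"
  obtains f g where "smooth_on UNIV f" "smooth_on UNIV g" "\<And>p. ext_d f p = \<phi> p"
    "\<And>p v. \<theta>\<^sub>1 p v = exp (\<mu> * f p) * ext_d g p v"
proof -
  obtain f where f: "smooth_on UNIV f" "\<And>p. ext_d f p = \<phi> p"
    by (rule poincare_lemma[OF lin(2) smooth(2)]) (use d\<phi> in \<open>auto simp: \<theta>\<^sub>2\<close>)
  \<comment> \<open>The integrating factor: dE = - \<mu> E \<phi> cancels the right-hand side of
    d\<theta>\<open>\<^sub>1\<close> in the derivative of the product.\<close>
  define E where "E = (\<lambda>q. exp (- \<mu> * f q))"
  have mf: "smooth_on UNIV (\<lambda>q. - \<mu> * f q)"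
    by (intro smooth_on_mult smooth_on_const f) auto
  have E: "smooth_on UNIV E"
    unfolding E_def by (intro smooth_on_exp mf) auto
  have dE: "ext_d E p v = - \<mu> * E p * \<phi> p v" for p v
    unfolding E_def ext_d_exp[OF mf] by (subst ext_d_cmult[OF f(1)]) (simp add: f)
  obtain g where g: "smooth_on UNIV g" "\<And>p. ext_d g p = (\<lambda>v. E p * \<theta>\<^sub>1 p v)"
  proof (rule poincare_lemma[of "\<lambda>p v. E p * \<theta>\<^sub>1 p v"])
    show "linear (\<lambda>v. E p * \<theta>\<^sub>1 p v)" for p
      using lin(1)[of p] by (auto intro!: linearI simp: linear_add linear_cmul algebra_simps)
    show "smooth_on UNIV (\<lambda>p. E p * \<theta>\<^sub>1 p v)" for v
      by (intro smooth_on_mult E smooth) auto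
    fix p u v
    have "ext_d (\<lambda>q. \<theta>\<^sub>1 q v) p u
        = ext_d (\<lambda>q. \<theta>\<^sub>1 q u) p v + \<mu> * (\<phi> p u * \<theta>\<^sub>1 p v - \<phi> p v * \<theta>\<^sub>1 p u)"
      using d\<theta>\<^sub>1[of v p u] by (simp add: \<theta>\<^sub>2 algebra_simps)
    then have "E p * ext_d (\<lambda>q. \<theta>\<^sub>1 q v) p u
        = E p * (ext_d (\<lambda>q. \<theta>\<^sub>1 q u) p v + \<mu> * (\<phi> p u * \<theta>\<^sub>1 p v - \<phi> p v * \<theta>\<^sub>1 p u))"
      by simp
    then show "ext_d (\<lambda>q. E q * \<theta>\<^sub>1 q v) p u = ext_d (\<lambda>q. E q * \<theta>\<^sub>1 q u) p v"
      unfolding ext_d_mult[OF E smooth(1)] dE by (simp add: algebra_simps)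
  qed blast
  have "\<theta>\<^sub>1 p v = exp (\<mu> * f p) * ext_d g p v" for p v
    by (simp add: g(2) E_def exp_minus)
  then show ?thesis
    by (rule that[OF f(1) g(1) f(2)])
qed

section \<open>Bivectors and connections\<close>

lemma wedge_in_ext_square: "u \<in> V \<Longrightarrow> v \<in> V \<Longrightarrow> u \<and>\<^sub>\<Lambda> v \<in> ext_square V"
  unfolding ext_square_def by (rule span_base) auto

lemma subspace_ext_square: "subspace (ext_square V)"
  unfolding ext_square_def by (rule subspace_span)

section \<open>The induced metric on bivectors of a pseudo-orthonormal basis\<close>

context
  fixes V :: "'v::real_vector set" and g :: "'v \<Rightarrow> 'v \<Rightarrow> real" and g2 and b :: "4 \<Rightarrow> 'v"
  assumes b: "\<And>i. b i \<in> V"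
    and po: "pseudo_orthonormal g b"
    and bil: "bilinear_form_on (ext_square V) g2"
    and g2: "\<And>u v w z. u \<in> V \<Longrightarrow> v \<in> V \<Longrightarrow> w \<in> V \<Longrightarrow> z \<in> V \<Longrightarrow>
      g2 (u \<and>\<^sub>\<Lambda> v) (w \<and>\<^sub>\<Lambda> z) = g u w * g v z - g u z * g v w"
begin

lemmas ext_square_intros =
  wedge_in_ext_square b subspace_add[OF subspace_ext_square] subspace_scale[OF subspace_ext_square]

lemma g2_linear:
  "\<theta> \<in> ext_square V \<Longrightarrow> \<theta>' \<in> ext_square V \<Longrightarrow> \<psi> \<in> ext_square V \<Longrightarrow> g2 (\<theta> + \<theta>') \<psi> = g2 \<theta> \<psi> + g2 \<theta>' \<psi>"
  "\<theta> \<in> ext_square V \<Longrightarrow> \<psi> \<in> ext_square V \<Longrightarrow> g2 (c *\<^sub>R \<theta>) \<psi> = c * g2 \<theta> \<psi>"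
  "\<theta> \<in> ext_square V \<Longrightarrow> \<theta>' \<in> ext_square V \<Longrightarrow> \<psi> \<in> ext_square V \<Longrightarrow> g2 \<psi> (\<theta> + \<theta>') = g2 \<psi> \<theta> + g2 \<psi> \<theta>'"
  "\<theta> \<in> ext_square V \<Longrightarrow> \<psi> \<in> ext_square V \<Longrightarrow> g2 \<psi> (c *\<^sub>R \<theta>) = c * g2 \<psi> \<theta>"
  using bil unfolding bilinear_form_on_def by auto

lemma g_basis: "g (b i) (b j) = (if i \<noteq> j then 0 else if i \<in> {1, 2} then 1 else -1)"
  using po unfolding pseudo_orthonormal_def by blast

lemma Omega_in_ext_square:
  "Omega1 \<epsilon> b \<in> ext_square V" "Omega2 \<epsilon> b \<in> ext_square V" "Omega3 \<epsilon> b \<in> ext_square V"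
  unfolding Omega1_def Omega2_def Omega3_def by (intro ext_square_intros)+

text \<open>The bivectors \<open>b i \<and>\<^sub>\<Lambda> b j\<close> with i < j are pairwise
  orthogonal, of square norm \<open>g (b i) (b i) * g (b j) (b j)\<close>, and different Omegas
  involve different ones. For a sign \<epsilon> the norms are 1, -1, -1.\<close>

lemma g2_Omega:
  "g2 (Omega1 \<epsilon> b) (Omega1 \<epsilon> b) = (1 + \<epsilon>\<^sup>2) / 2"
  "g2 (Omega2 \<epsilon> b) (Omega2 \<epsilon> b) = - (1 + \<epsilon>\<^sup>2) / 2"
  "g2 (Omega3 \<epsilon> b) (Omega3 \<epsilon> b) = - (1 + \<epsilon>\<^sup>2) / 2"
  "g2 (Omega1 \<delta> b) (Omega3 \<epsilon> b) = 0" "g2 (Omega3 \<epsilon> b) (Omega1 \<delta> b) = 0"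
  unfolding Omega1_def Omega2_def Omega3_def
  by (simp_all add: g2_linear ext_square_intros g2 g_basis field_simps power2_eq_square)

text \<open>Pairing with the two Omegas recovers \<open>x\<close> and \<open>- y\<close>, so they
  are independent, and the square norm is \<open>x\<^sup>2 - y\<^sup>2\<close>. Admitting zero
  alongside light-like vectors leaves just the quadratic equation.\<close>

lemma light_like_Omega_combination:
  fixes \<epsilon> :: real
  assumes \<epsilon>: "\<epsilon>\<^sup>2 = 1"
  defines "\<theta> \<equiv> \<lambda>x y. x *\<^sub>R Omega1 (-\<epsilon>) b + y *\<^sub>R Omega3 \<epsilon> b"
  shows "\<theta> x y = 0 \<longleftrightarrow> x = 0 \<and> y = 0"
    and "light_like g2 (\<theta> x y) \<or> \<theta> x y = 0 \<longleftrightarrow> x\<^sup>2 = y\<^sup>2"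
proof -
  have i: "x *\<^sub>R Omega1 (-\<epsilon>) b \<in> ext_square V" "y *\<^sub>R Omega3 \<epsilon> b \<in> ext_square V" "\<theta> x y \<in> ext_square V"
    unfolding \<theta>_def by (intro ext_square_intros Omega_in_ext_square)+
  have 1: "g2 (\<theta> x y) (Omega1 (-\<epsilon>) b) = x"
      "g2 (\<theta> x y) (Omega3 \<epsilon> b) = - y"
    unfolding \<theta>_def by (simp_all add: g2_linear i[unfolded \<theta>_def] Omega_in_ext_square g2_Omega \<epsilon>)
  have "g2 (\<theta> x y) (\<theta> x y) = x * g2 (\<theta> x y) (Omega1 (-\<epsilon>) b) + y * g2 (\<theta> x y) (Omega3 \<epsilon> b)"
    by (subst (2) \<theta>_def) (simp add: g2_linear i Omega_in_ext_square)
  then have 2: "g2 (\<theta> x y) (\<theta> x y) = x\<^sup>2 - y\<^sup>2"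
    by (simp add: 1 power2_eq_square)
  have z: "g2 0 \<psi> = 0" if "\<psi> \<in> ext_square V" for \<psi>
    using g2_linear(2)[OF that that, of 0] by simp
  show 3: "\<theta> x y = 0 \<longleftrightarrow> x = 0 \<and> y = 0"
  proof
    assume 0: "\<theta> x y = 0"
    show "x = 0 \<and> y = 0"
      using 1[unfolded 0] by (simp add: z Omega_in_ext_square)
  qed (simp add: \<theta>_def)
  show "light_like g2 (\<theta> x y) \<or> \<theta> x y = 0 \<longleftrightarrow> x\<^sup>2 = y\<^sup>2"
    using 2 3 by (auto simp: light_like_def)
qed

end

section \<open>Smooth sections of the exterior square and elementary rules for connections\<close>

context
  fixes E :: "'x::euclidean_space \<Rightarrow> 'v::real_vector set"
    and \<A> :: "('x, 'v, 'k::finite) trivialisations"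
  assumes vb: "vector_bundle E \<A>"
begin

text \<open>Linearity of the coordinate functionals ensures that \<open>Rep_bivector\<close> yields
  a true coefficient there and not its default value 0.\<close>

lemma trivialisation:
  assumes "(U, \<phi>) \<in> \<A>"
  shows "open U" "p \<in> U \<Longrightarrow> linear (\<lambda>u. \<phi> p u $ i)"
proof -
  show "open U"
    using vb assms unfolding vector_bundle_def by blast
  assume "p \<in> U"
  then have "linear (\<phi> p)"
    using vb assms unfolding vector_bundle_def by blast
  then show "linear (\<lambda>u. \<phi> p u $ i)"
    by (intro linearI) (simp_all add: linear_add linear_cmul)
qed

lemma bivector_sections_wedge:
  assumes "s \<in> sections E \<A>" "t \<in> sections E \<A>"
  shows "(\<lambda>p. s p \<and>\<^sub>\<Lambda> t p) \<in> bivector_sections E \<A>"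
proof -
  have "smooth_on U (\<lambda>p. Rep_bivector (s p \<and>\<^sub>\<Lambda> t p) (\<lambda>u. \<phi> p u $ i) (\<lambda>u. \<phi> p u $ j))"
    if T: "(U, \<phi>) \<in> \<A>" for U \<phi> i j
  proof -
    have "smooth_on U (\<lambda>p. \<phi> p (s p) $ i)" "smooth_on U (\<lambda>p. \<phi> p (t p) $ i)" for i
      using assms T trivialisation(1)[OF T]
      by (auto simp: sections_on_def intro!: smooth_on_bounded_linear[OF _ bounded_linear_vec_nth])
    \<comment> \<open>The coefficients of a wedge are 2 by 2 minors of the coordinates; agreement
      with them on the open set \<open>U\<close> is enough for smoothness.\<close>
    then have "smooth_on U (\<lambda>p. \<phi> p (s p) $ i * \<phi> p (t p) $ j - \<phi> p (t p) $ i * \<phi> p (s p) $ j)"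
      using trivialisation(1)[OF T] by (intro smooth_on_diff smooth_on_mult)
    then show ?thesis
      by (subst smooth_on_cong[OF trivialisation(1)[OF T]])
        (auto simp: Rep_bivector_wedge trivialisation(2)[OF T])
  qed
  moreover have "s p \<and>\<^sub>\<Lambda> t p \<in> ext_square (E p)" for p
    using assms by (intro wedge_in_ext_square) (auto simp: sections_on_def)
  ultimately show ?thesis
    by (auto simp: bivector_sections_def)
qed

lemma bivector_sections_add:
  assumes "\<Theta> \<in> bivector_sections E \<A>" "\<Psi> \<in> bivector_sections E \<A>"
  shows "(\<lambda>p. \<Theta> p + \<Psi> p) \<in> bivector_sections E \<A>"
  using assms trivialisation(1) unfolding bivector_sections_def
  by (auto simp: Rep_bivector_plus intro!: smooth_on_add subspace_add[OF subspace_ext_square])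

lemma bivector_sections_scaleR:
  assumes "\<Theta> \<in> bivector_sections E \<A>"
  shows "(\<lambda>p. c *\<^sub>R \<Theta> p) \<in> bivector_sections E \<A>"
  using assms trivialisation(1) unfolding bivector_sections_def
  by (auto simp: Rep_bivector_scaleR
      intro!: smooth_on_mult smooth_on_const subspace_scale[OF subspace_ext_square])

end

lemma connection_add:
  assumes "connection \<Gamma> D" "s \<in> \<Gamma>" "t \<in> \<Gamma>"
  shows "D (\<lambda>q. s q + t q) p v = D s p v + D t p v"
  using assms unfolding connection_def by blast

lemma connection_scaleR:
  assumes "connection \<Gamma> D" "s \<in> \<Gamma>"
  shows "D (\<lambda>q. c *\<^sub>R s q) p v = c *\<^sub>R D s p v"
proof -
  have "D (\<lambda>q. (\<lambda>_. c) q *\<^sub>R s q) p v = ext_d (\<lambda>_. c) p v *\<^sub>R s p + c *\<^sub>R D s p v"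
    using assms smooth_on_const[OF open_UNIV, of c] unfolding connection_def by blast
  then show ?thesis by (simp add: ext_d_const)
qed

text \<open>Constant fields have zero bracket, and \<open>D s p\<close> maps 0 to 0.\<close>

lemma curvature_const:
  assumes "connection \<Gamma> D" "s \<in> \<Gamma>"
  shows "curvature D (\<lambda>_. u) (\<lambda>_. v) s p = D (\<lambda>q. D s q v) p u - D (\<lambda>q. D s q u) p v"
proof -
  have "linear (D s p)"
    using assms unfolding connection_def by blast
  then show ?thesis
    by (simp add: curvature_def lie_bracket_def linear_0)
qed

section \<open>The connection form of a flat metric connection\<close>

locale flat_neutral_frame =
  fixes E :: "'x::euclidean_space \<Rightarrow> 'v::real_vector set"
    and \<A> :: "('x, 'v, 4) trivialisations"
    and h :: "'x \<Rightarrow> 'v \<Rightarrow> 'v \<Rightarrow> real"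
    and D :: "('x \<Rightarrow> 'v) \<Rightarrow> 'x \<Rightarrow> 'x \<Rightarrow> 'v"
    and e :: "4 \<Rightarrow> 'x \<Rightarrow> 'v"
    and \<omega> :: "4 \<Rightarrow> 4 \<Rightarrow> 'x \<Rightarrow> 'x \<Rightarrow> real"
  assumes vb: "vector_bundle E \<A>"
    and metric: "neutral_metric E \<A> h"
    and metric_conn: "metric_connection (sections E \<A>) h D"
    and flat: "flat (sections E \<A>) D"
    and frame: "pseudo_orthonormal_frame E \<A> h e"
    and form: "connection_form D e \<omega>"
begin

text \<open>The square norms of the frame vectors. Each is its own inverse, so raising and lowering
  an index are the same multiplication.\<close>

definition \<eta> :: "4 \<Rightarrow> real" where
  "\<eta> i = (if i \<in> {1, 2} then 1 else -1)"

lemma e_section: "e i \<in> sections E \<A>"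
  using frame unfolding pseudo_orthonormal_frame_def by blast

lemma e_fibre: "e i p \<in> E p"
  using e_section unfolding sections_on_def by blast

lemma conn: "connection (sections E \<A>) D"
  using metric_conn unfolding metric_connection_def by blast

lemma D_section: "s \<in> sections E \<A> \<Longrightarrow> (\<lambda>p. D s p v) \<in> sections E \<A>"
  using conn unfolding connection_def by blast

lemma pseudo_orthonormal_e: "pseudo_orthonormal (h p) (\<lambda>i. e i p)"
  using frame unfolding pseudo_orthonormal_frame_def by blast

lemma h_e: "h p (e i p) (e j p) = (if i = j then \<eta> i else 0)"
  using pseudo_orthonormal_e[of p] unfolding pseudo_orthonormal_def \<eta>_def by auto

lemma subspace_E: "subspace (E p)"
  using vb unfolding vector_bundle_def by blast

lemma h_linear:
  "u \<in> E p \<Longrightarrow> v \<in> E p \<Longrightarrow> w \<in> E p \<Longrightarrow> h p (u + v) w = h p u w + h p v w"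
  "u \<in> E p \<Longrightarrow> w \<in> E p \<Longrightarrow> h p (c *\<^sub>R u) w = c * h p u w"
  "u \<in> E p \<Longrightarrow> v \<in> E p \<Longrightarrow> w \<in> E p \<Longrightarrow> h p w (u + v) = h p w u + h p w v"
  "u \<in> E p \<Longrightarrow> w \<in> E p \<Longrightarrow> h p w (c *\<^sub>R u) = c * h p w u"
  using metric unfolding neutral_metric_def neutral_form_on_def bilinear_form_on_def by blast+

lemma h_frame_sum:
  "h p (\<Sum>i\<in>UNIV. x i *\<^sub>R e i p) (\<Sum>i\<in>UNIV. y i *\<^sub>R e i p) = (\<Sum>i\<in>UNIV. \<eta> i * (x i * y i))"
  by (simp add: sum_4 h_linear subspace_add[OF subspace_E] subspace_scale[OF subspace_E] e_fibre h_e)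

lemma D_e: "D (e j) p v = (\<Sum>i\<in>UNIV. \<omega> i j p v *\<^sub>R e i p)"
  using form unfolding connection_form_def by blast

lemma h_D_e_D_e: "h p (D (e i) p u) (D (e j) p v) = (\<Sum>k\<in>UNIV. \<eta> k * (\<omega> k i p u * \<omega> k j p v))"
  unfolding D_e by (rule h_frame_sum)

lemma h_D_e: "h p (D (e j) p v) (e i p) = \<eta> i * \<omega> i j p v"
proof -
  \<comment> \<open>Writing \<open>e i p\<close> as a frame sum with indicator coefficients brings
    the pairing into the form of \<open>h_frame_sum\<close>.\<close>
  have "h p (D (e j) p v) (\<Sum>k\<in>UNIV. (if k = i then 1 else 0) *\<^sub>R e k p)
      = (\<Sum>k\<in>UNIV. \<eta> k * (\<omega> k j p v * (if k = i then 1 else 0)))"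
    unfolding D_e by (rule h_frame_sum)
  moreover have "(\<Sum>k\<in>UNIV. (if k = i then 1 else 0) *\<^sub>R e k p) = e i p"
    by (simp add: if_distrib[of "\<lambda>c. c *\<^sub>R _"] cong: if_cong)
  ultimately have "h p (D (e j) p v) (e i p)
      = (\<Sum>k\<in>UNIV. \<eta> k * (\<omega> k j p v * (if k = i then 1 else 0)))"
    by simp
  also have "\<dots> = \<eta> i * \<omega> i j p v"
    by (simp add: if_distrib[of "\<lambda>c. _ * c"] cong: if_cong)
  finally show ?thesis .
qed

lemma h_sym: "u \<in> E p \<Longrightarrow> v \<in> E p \<Longrightarrow> h p u v = h p v u"
  using metric unfolding neutral_metric_def neutral_form_on_def by blast

lemma D_e_fibre: "D (e j) p v \<in> E p"
  using D_section[OF e_section] unfolding sections_on_def by blast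

lemma h_e_D: "h p (e i p) (D (e j) p v) = \<eta> i * \<omega> i j p v"
  using h_D_e h_sym D_e_fibre e_fibre by metis

lemma \<eta>_square: "\<eta> i * (\<eta> i * x) = x"
  by (simp add: \<eta>_def)

text \<open>Recovers the connection form from the metric and the connection, so that its smoothness
  and linearity, which \<open>connection_form\<close> does not state, follow from theirs.\<close>

lemma \<omega>_eq: "\<omega> i j p v = \<eta> i * h p (D (e j) p v) (e i p)"
  by (simp add: h_D_e \<eta>_square)

lemma h_smooth: "s \<in> sections E \<A> \<Longrightarrow> t \<in> sections E \<A> \<Longrightarrow> smooth_on UNIV (\<lambda>p. h p (s p) (t p))"
  using metric unfolding neutral_metric_def by blast

lemma \<omega>_smooth: "smooth_on UNIV (\<lambda>p. \<omega> i j p v)"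
  unfolding \<omega>_eq by (intro smooth_on_mult smooth_on_const h_smooth D_section e_section) auto

lemma \<omega>_linear: "linear (\<omega> i j p)"
proof -
  have "linear (D (e j) p)"
    using conn e_section unfolding connection_def by blast
  then have l: "D (e j) p (u + v) = D (e j) p u + D (e j) p v" "D (e j) p (c *\<^sub>R u) = c *\<^sub>R D (e j) p u"
    for u v c
    by (simp_all add: linear_add linear_cmul)
  show ?thesis
    by (rule linearI) (simp_all add: \<omega>_eq l h_linear D_e_fibre e_fibre algebra_simps)
qed

lemma metric_compatible:
  assumes "s \<in> sections E \<A>" "t \<in> sections E \<A>"
  shows "ext_d (\<lambda>q. h q (s q) (t q)) p v = h p (D s p v) (t p) + h p (s p) (D t p v)"
  using metric_conn assms unfolding metric_connection_def by blast

text \<open>The products of frame vectors are constant; differentiating them places the connection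
  form in so(2,2).\<close>

lemma \<omega>_skew: "\<eta> i * \<omega> i j p v + \<eta> j * \<omega> j i p v = 0"
  using metric_compatible[OF e_section e_section, of j i p v] by (simp add: h_e h_D_e h_e_D ext_d_const)

text \<open>Skew for two vectors of the same causal type, symmetric for mixed ones. As rewrite rules
  these leave only the six forms with row index above column index, in which the theorem is
  phrased.\<close>

lemma \<omega>_simps:
  "\<omega> i i p v = 0"
  "\<omega> 1 2 p v = - \<omega> 2 1 p v" "\<omega> 1 3 p v = \<omega> 3 1 p v" "\<omega> 1 4 p v = \<omega> 4 1 p v"
  "\<omega> 2 3 p v = \<omega> 3 2 p v" "\<omega> 2 4 p v = \<omega> 4 2 p v" "\<omega> 3 4 p v = - \<omega> 4 3 p v"
  using \<omega>_skew[of i i p v] \<omega>_skew[of 1 2 p v] \<omega>_skew[of 1 3 p v] \<omega>_skew[of 1 4 p v]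
    \<omega>_skew[of 2 3 p v] \<omega>_skew[of 2 4 p v] \<omega>_skew[of 3 4 p v]
  by (auto simp: \<eta>_def split: if_splits)

text \<open>Flatness is paired with \<open>e i\<close> for constant vector fields \<open>u\<close>, \<open>v\<close>; the quadratic terms
  come from metric compatibility.\<close>

lemma structure_equation:
  "ext_d (\<lambda>q. \<omega> i j q v) p u - ext_d (\<lambda>q. \<omega> i j q u) p v
     = \<eta> i * (\<Sum>k\<in>UNIV. \<eta> k * (\<omega> k j p v * \<omega> k i p u - \<omega> k j p u * \<omega> k i p v))"
proof -
  have d: "ext_d (\<lambda>q. \<omega> i j q v) p u
      = \<eta> i * (h p (D (\<lambda>q. D (e j) q v) p u) (e i p) + h p (D (e j) p v) (D (e i) p u))" for u v
    unfolding \<omega>_eq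
    by (simp add: ext_d_cmult h_smooth D_section e_section metric_compatible)
  have "D (\<lambda>q. D (e j) q v) p u - D (\<lambda>q. D (e j) q u) p v = 0"
    using flat e_section[of j] smooth_on_const[OF open_UNIV]
    unfolding flat_def curvature_const[OF conn e_section, symmetric] by blast
  then show ?thesis
    by (simp add: d h_D_e_D_e sum_subtractf algebra_simps)
qed

section \<open>The splitting of the connection form into its two halves\<close>

definition \<theta>\<^sub>1 :: "real \<Rightarrow> 'x \<Rightarrow> 'x \<Rightarrow> real" where
  "\<theta>\<^sub>1 \<epsilon> p v = \<omega> 3 2 p v + \<epsilon> * \<omega> 4 1 p v"

definition \<theta>\<^sub>2 :: "real \<Rightarrow> 'x \<Rightarrow> 'x \<Rightarrow> real" where
  "\<theta>\<^sub>2 \<epsilon> p v = \<omega> 4 3 p v + \<epsilon> * \<omega> 2 1 p v"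

text \<open>For a sign \<epsilon> this is, up to sign, the remaining coefficient of the induced
  connection on the rank-3 bundle, coupling \<open>Omega1 (- \<epsilon>)\<close> and
  \<open>Omega3 \<epsilon>\<close>.\<close>

definition \<phi> :: "real \<Rightarrow> 'x \<Rightarrow> 'x \<Rightarrow> real" where
  "\<phi> \<epsilon> p v = \<epsilon> * \<omega> 3 1 p v - \<omega> 4 2 p v"

lemma forms_linear: "linear (\<theta>\<^sub>1 \<epsilon> p)" "linear (\<theta>\<^sub>2 \<epsilon> p)" "linear (\<phi> \<epsilon> p)"
  by (auto intro!: linearI simp: \<theta>\<^sub>1_def \<theta>\<^sub>2_def \<phi>_def linear_add[OF \<omega>_linear]
      linear_cmul[OF \<omega>_linear] algebra_simps)

lemma forms_smooth:
  "smooth_on UNIV (\<lambda>p. \<theta>\<^sub>1 \<epsilon> p v)" "smooth_on UNIV (\<lambda>p. \<theta>\<^sub>2 \<epsilon> p v)" "smooth_on UNIV (\<lambda>p. \<phi> \<epsilon> p v)"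
  unfolding \<theta>\<^sub>1_def \<theta>\<^sub>2_def \<phi>_def
  by (intro smooth_on_add smooth_on_diff smooth_on_mult smooth_on_const \<omega>_smooth open_UNIV)+

lemma ext_d_forms:
  "ext_d (\<lambda>q. \<theta>\<^sub>1 \<epsilon> q v) p u = ext_d (\<lambda>q. \<omega> 3 2 q v) p u + \<epsilon> * ext_d (\<lambda>q. \<omega> 4 1 q v) p u"
  "ext_d (\<lambda>q. \<phi> \<epsilon> q v) p u = \<epsilon> * ext_d (\<lambda>q. \<omega> 3 1 q v) p u - ext_d (\<lambda>q. \<omega> 4 2 q v) p u"
proof -
  have s: "smooth_on UNIV (\<lambda>q. c * \<omega> i j q v)" for i j c
    by (intro smooth_on_mult smooth_on_const \<omega>_smooth open_UNIV)
  show "ext_d (\<lambda>q. \<theta>\<^sub>1 \<epsilon> q v) p u = ext_d (\<lambda>q. \<omega> 3 2 q v) p u + \<epsilon> * ext_d (\<lambda>q. \<omega> 4 1 q v) p u"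
    unfolding \<theta>\<^sub>1_def by (simp add: ext_d_add[OF \<omega>_smooth s] ext_d_cmult[OF \<omega>_smooth])
  have "\<phi> \<epsilon> q v = \<epsilon> * \<omega> 3 1 q v + (-1) * \<omega> 4 2 q v" for q
    by (simp add: \<phi>_def)
  then show "ext_d (\<lambda>q. \<phi> \<epsilon> q v) p u = \<epsilon> * ext_d (\<lambda>q. \<omega> 3 1 q v) p u - ext_d (\<lambda>q. \<omega> 4 2 q v) p u"
    by (simp only: ext_d_add[OF s s] ext_d_cmult[OF \<omega>_smooth])
qed

text \<open>This reflects the splitting of so(2,2) into two copies of so(1,2): as \<epsilon> is a
  sign, the quadratic terms regroup into products of the three forms for the same
  \<epsilon>.\<close>

lemma structure_equation_forms:
  assumes "\<epsilon> \<in> {1, -1}"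
  shows "ext_d (\<lambda>q. \<phi> \<epsilon> q v) p u - ext_d (\<lambda>q. \<phi> \<epsilon> q u) p v
      = - (\<theta>\<^sub>1 \<epsilon> p u * \<theta>\<^sub>2 \<epsilon> p v - \<theta>\<^sub>1 \<epsilon> p v * \<theta>\<^sub>2 \<epsilon> p u)"
    and "ext_d (\<lambda>q. \<theta>\<^sub>1 \<epsilon> q v) p u - ext_d (\<lambda>q. \<theta>\<^sub>1 \<epsilon> q u) p v
      = \<phi> \<epsilon> p u * \<theta>\<^sub>2 \<epsilon> p v - \<phi> \<epsilon> p v * \<theta>\<^sub>2 \<epsilon> p u"
  using structure_equation[of 3 2 v p u] structure_equation[of 4 1 v p u]
    structure_equation[of 3 1 v p u] structure_equation[of 4 2 v p u] assms
  unfolding ext_d_forms unfolding \<theta>\<^sub>1_def \<theta>\<^sub>2_def \<phi>_def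
  by (auto simp: sum_4 \<eta>_def \<omega>_simps algebra_simps)

end

section \<open>The covariant derivative of \<open>Omega2\<close> and the light-like
  condition\<close>

context flat_neutral_frame
begin

lemma Omega2_bivector_section: "(\<lambda>p. Omega2 \<epsilon> (\<lambda>i. e i p)) \<in> bivector_sections E \<A>"
  unfolding Omega2_def
  by (intro bivector_sections_scaleR[OF vb] bivector_sections_add[OF vb]
      bivector_sections_wedge[OF vb] e_section)

text \<open>Product rule on each wedge, then comparison of coefficients. The \<open>Omega2\<close>
  component drops out because \<open>\<omega> i i\<close> vanishes; skewness regroups the
  rest.\<close>

lemma D2_Omega2:
  assumes D2: "induced_connection E \<A> D D2" and \<epsilon>: "\<epsilon> \<in> {1, -1}"
  shows "D2 (\<lambda>p. Omega2 \<epsilon> (\<lambda>i. e i p)) p v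
    = \<theta>\<^sub>1 \<epsilon> p v *\<^sub>R Omega1 (- \<epsilon>) (\<lambda>i. e i p) + \<theta>\<^sub>2 \<epsilon> p v *\<^sub>R Omega3 \<epsilon> (\<lambda>i. e i p)"
proof -
  have c: "connection (bivector_sections E \<A>) D2"
    using D2 unfolding induced_connection_def by blast
  have w: "D2 (\<lambda>q. e i q \<and>\<^sub>\<Lambda> e j q) p v = D (e i) p v \<and>\<^sub>\<Lambda> e j p + e i p \<and>\<^sub>\<Lambda> D (e j) p v" for i j
    using D2 e_section unfolding induced_connection_def by blast
  note sections = bivector_sections_scaleR[OF vb] bivector_sections_add[OF vb]
    bivector_sections_wedge[OF vb] e_section
  have "D2 (\<lambda>p. Omega2 \<epsilon> (\<lambda>i. e i p)) p v
      = (1 / sqrt 2) *\<^sub>R (D (e 1) p v \<and>\<^sub>\<Lambda> e 3 p + e 1 p \<and>\<^sub>\<Lambda> D (e 3) p v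
          + \<epsilon> *\<^sub>R (D (e 4) p v \<and>\<^sub>\<Lambda> e 2 p + e 4 p \<and>\<^sub>\<Lambda> D (e 2) p v))"
    unfolding Omega2_def by (simp only: connection_scaleR[OF c] connection_add[OF c] sections w)
  also have "D (e 1) p v \<and>\<^sub>\<Lambda> e 3 p + e 1 p \<and>\<^sub>\<Lambda> D (e 3) p v
          + \<epsilon> *\<^sub>R (D (e 4) p v \<and>\<^sub>\<Lambda> e 2 p + e 4 p \<and>\<^sub>\<Lambda> D (e 2) p v)
      = \<theta>\<^sub>1 \<epsilon> p v *\<^sub>R (e 1 p \<and>\<^sub>\<Lambda> e 2 p + (- \<epsilon>) *\<^sub>R (e 3 p \<and>\<^sub>\<Lambda> e 4 p))
        + \<theta>\<^sub>2 \<epsilon> p v *\<^sub>R (e 1 p \<and>\<^sub>\<Lambda> e 4 p + \<epsilon> *\<^sub>R (e 2 p \<and>\<^sub>\<Lambda> e 3 p))"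
    (is "?l = ?r")
  proof -
    \<comment> \<open>Bivectors are compared as functions of two functionals; if one of these is not
      linear, both sides take the default value 0.\<close>
    have "Rep_bivector ?l \<alpha> \<beta> = Rep_bivector ?r \<alpha> \<beta>" for \<alpha> \<beta>
    proof (cases "linear \<alpha> \<and> linear \<beta>")
      case True
      then have l: "linear \<alpha>" "linear \<beta>" by auto
      show ?thesis
        using \<epsilon> unfolding Rep_bivector_plus Rep_bivector_scaleR Rep_bivector_wedge
        by (auto simp: l D_e sum_4
            linear_add[OF l(1)] linear_add[OF l(2)] linear_cmul[OF l(1)] linear_cmul[OF l(2)]
            linear_diff[OF l(1)] linear_diff[OF l(2)] linear_neg[OF l(1)] linear_neg[OF l(2)]
            \<omega>_simps \<theta>\<^sub>1_def \<theta>\<^sub>2_def algebra_simps)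
    next
      case False
      then show ?thesis
        unfolding Rep_bivector_plus Rep_bivector_scaleR Rep_bivector_wedge by auto
    qed
    then show ?thesis
      by (simp add: Rep_bivector_inject[symmetric] fun_eq_iff)
  qed
  finally show ?thesis
    by (simp add: Omega1_def Omega3_def scaleR_add_right mult.commute)
qed

text \<open>Membership in the twistor space is automatic for a positive pseudo-orthonormal frame, so
  only the pointwise condition on the two coefficients of the derivative remains. Since their
  squares agree, the derivative is nonzero exactly where \<open>\<theta>\<^sub>1\<close> is.\<close>

lemma fully_light_like_iff:
  assumes h2: "induced_metric E h h2" and D2: "induced_connection E \<A> D D2"
    and pos: "\<And>p. (\<lambda>i. e i p) \<in> \<O> p" and \<epsilon>: "\<epsilon> \<in> {1, -1}"
  shows "fully_light_like_twistor_section E \<A> \<epsilon> h \<O> h2 D2 (\<lambda>p. Omega2 \<epsilon> (\<lambda>i. e i p)) \<longleftrightarrow>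
    (\<forall>p. (\<forall>v. (\<theta>\<^sub>1 \<epsilon> p v)\<^sup>2 = (\<theta>\<^sub>2 \<epsilon> p v)\<^sup>2) \<and> (\<exists>v. \<theta>\<^sub>1 \<epsilon> p v \<noteq> 0))"
proof -
  let ?b = "\<lambda>p i. e i p"
  have bil: "bilinear_form_on (ext_square (E p)) (h2 p)"
    and wedge: "\<And>u v w z. u \<in> E p \<Longrightarrow> v \<in> E p \<Longrightarrow> w \<in> E p \<Longrightarrow> z \<in> E p \<Longrightarrow>
      h2 p (u \<and>\<^sub>\<Lambda> v) (w \<and>\<^sub>\<Lambda> z) = h p u w * h p v z - h p u z * h p v w" for p
    using h2 unfolding induced_metric_def by blast+
  have \<epsilon>2: "\<epsilon>\<^sup>2 = 1"
    using \<epsilon> by auto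
  note fibre = e_fibre pseudo_orthonormal_e bil wedge
  have "Omega2 \<epsilon> (?b p) \<in> timelike_twistor_space \<epsilon> h \<O> h2 p" for p
  proof -
    have "h2 p (Omega2 \<epsilon> (?b p)) (Omega2 \<epsilon> (?b p)) = -1"
      using g2_Omega(2)[of "?b p" "E p" "h p" "h2 p" \<epsilon>, OF fibre] \<epsilon>2 by simp
    moreover have "Omega2 \<epsilon> (?b p) \<in> half_ext_square \<epsilon> (h p) (\<O> p)"
      unfolding half_ext_square_def using pos[of p] pseudo_orthonormal_e[of p]
      by (intro span_base) blast
    ultimately show ?thesis
      by (simp add: timelike_twistor_space_def)
  qed
  then have "(\<lambda>p. Omega2 \<epsilon> (?b p)) \<in> timelike_twistor_sections E \<A> \<epsilon> h \<O> h2"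
    by (simp add: timelike_twistor_sections_def Omega2_bivector_section)
  moreover note comb = light_like_Omega_combination[of "?b p" "E p" "h p" "h2 p" \<epsilon> for p, OF fibre \<epsilon>2]
  ultimately show ?thesis
    unfolding fully_light_like_twistor_section_def D2_Omega2[OF D2 \<epsilon>] comb
    by (auto simp: power2_eq_iff) (metis power2_eq_iff zero_eq_power2)
qed

text \<open>Packages the forward direction for one \<epsilon>. It is applied once for each sign, and
  the two resulting values of \<mu> are independent.\<close>

lemma fully_light_like_potentials:
  assumes "\<epsilon> \<in> {1, -1}"
    and "\<And>p v. (\<theta>\<^sub>1 \<epsilon> p v)\<^sup>2 = (\<theta>\<^sub>2 \<epsilon> p v)\<^sup>2" "\<And>p. \<exists>v. \<theta>\<^sub>1 \<epsilon> p v \<noteq> 0"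
  obtains \<mu> f g where "\<mu> \<in> {1, -1}" "smooth_on UNIV f" "smooth_on UNIV g" "\<And>p. ext_d g p \<noteq> (\<lambda>_. 0)"
    "\<And>p v. \<phi> \<epsilon> p v = ext_d f p v" "\<And>p v. \<theta>\<^sub>1 \<epsilon> p v = exp (\<mu> * f p) * ext_d g p v"
    "\<And>p v. \<theta>\<^sub>2 \<epsilon> p v = \<mu> * (exp (\<mu> * f p) * ext_d g p v)"
proof -
  have cont: "continuous_on UNIV (\<lambda>p. \<theta>\<^sub>1 \<epsilon> p v)" "continuous_on UNIV (\<lambda>p. \<theta>\<^sub>2 \<epsilon> p v)" for v
    by (intro smooth_on_continuous forms_smooth open_UNIV)+
  obtain \<mu> where \<mu>: "\<mu> \<in> {1, -1}" "\<And>p v. \<theta>\<^sub>2 \<epsilon> p v = \<mu> * \<theta>\<^sub>1 \<epsilon> p v"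
    by (rule square_eq_imp_constant_sign[OF forms_linear(1,2) cont assms(2,3)]) blast
  obtain f g where fg: "smooth_on UNIV f" "smooth_on UNIV g" "\<And>p. ext_d f p = \<phi> \<epsilon> p"
      "\<And>p v. \<theta>\<^sub>1 \<epsilon> p v = exp (\<mu> * f p) * ext_d g p v"
    by (rule closed_form_potentials[OF forms_linear(1,3) forms_smooth(1,3)
          structure_equation_forms[OF assms(1)] \<mu>(2)]) blast
  \<comment> \<open>A zero of dg would be a zero of
    \<open>\<theta>\<^sub>1 \<epsilon>\<close>.\<close>
  have "ext_d g p \<noteq> (\<lambda>_. 0)" for p
    using assms(3)[of p] by (auto simp: fg(4))
  then show ?thesis
    using that[OF \<mu>(1) fg(1,2)] fg(3,4) \<mu>(2) by simp
qed

end

section \<open>Recombination of the two halves\<close>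

theorem theorem9p3:
  fixes E :: "real ^ 'm \<Rightarrow> 'v::real_vector set"
    and \<A> :: "(real ^ 'm, 'v, 4) trivialisations"
    and \<O> :: "real ^ 'm \<Rightarrow> (4 \<Rightarrow> 'v) set"
    and h :: "real ^ 'm \<Rightarrow> 'v \<Rightarrow> 'v \<Rightarrow> real"
    and D :: "(real ^ 'm \<Rightarrow> 'v) \<Rightarrow> real ^ 'm \<Rightarrow> real ^ 'm \<Rightarrow> 'v"
    and h2 :: "real ^ 'm \<Rightarrow> 'v bivector \<Rightarrow> 'v bivector \<Rightarrow> real"
    and D2 :: "(real ^ 'm \<Rightarrow> 'v bivector) \<Rightarrow> real ^ 'm \<Rightarrow> real ^ 'm \<Rightarrow> 'v bivector"
    and e :: "4 \<Rightarrow> real ^ 'm \<Rightarrow> 'v"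
    and \<omega> :: "4 \<Rightarrow> 4 \<Rightarrow> real ^ 'm \<Rightarrow> real ^ 'm \<Rightarrow> real"
  assumes "CARD('m) \<ge> 2"
    and "vector_bundle E \<A>"
    and "orientation E \<A> \<O>"
    and "neutral_metric E \<A> h"
    and "metric_connection (sections E \<A>) h D"
    and "flat (sections E \<A>) D"
    and "induced_metric E h h2"
    and "induced_connection E \<A> D D2"
    and "pseudo_orthonormal_frame E \<A> h e"
    and "\<And>p. (\<lambda>i. e i p) \<in> \<O> p"
    and "connection_form D e \<omega>"
  shows "(fully_light_like_twistor_section E \<A> 1 h \<O> h2 D2 (\<lambda>p. Omega2 1 (\<lambda>i. e i p)) \<and>
     fully_light_like_twistor_section E \<A> (-1) h \<O> h2 D2 (\<lambda>p. Omega2 (-1) (\<lambda>i. e i p)))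
    \<longleftrightarrow>
    (\<exists>fp fm gp gm :: real ^ 'm \<Rightarrow> real. \<exists>\<mu>\<in>{1, -1 :: real}.
       smooth_on UNIV fp \<and> smooth_on UNIV fm \<and> smooth_on UNIV gp \<and> smooth_on UNIV gm \<and>
       (\<forall>p. ext_d gp p \<noteq> (\<lambda>_. 0)) \<and> (\<forall>p. ext_d gm p \<noteq> (\<lambda>_. 0)) \<and>
       (\<forall>p v. \<omega> 3 1 p v = 1 / 2 * (ext_d fp p v - ext_d fm p v) \<and>
              \<omega> 4 2 p v = - (1 / 2) * (ext_d fp p v + ext_d fm p v)) \<and>
       ((\<forall>p v.
           \<omega> 2 1 p v = \<mu> / 2 * (exp (\<mu> * fp p) * ext_d gp p v - exp (\<mu> * fm p) * ext_d gm p v) \<and>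
           \<omega> 3 2 p v = 1 / 2 * (exp (\<mu> * fp p) * ext_d gp p v + exp (\<mu> * fm p) * ext_d gm p v) \<and>
           \<omega> 4 1 p v = 1 / 2 * (exp (\<mu> * fp p) * ext_d gp p v - exp (\<mu> * fm p) * ext_d gm p v) \<and>
           \<omega> 4 3 p v = \<mu> / 2 * (exp (\<mu> * fp p) * ext_d gp p v + exp (\<mu> * fm p) * ext_d gm p v))
        \<or>
        (\<forall>p v.
           \<omega> 2 1 p v = \<mu> / 2 * (exp (\<mu> * fp p) * ext_d gp p v + exp (- \<mu> * fm p) * ext_d gm p v) \<and>
           \<omega> 3 2 p v = 1 / 2 * (exp (\<mu> * fp p) * ext_d gp p v + exp (- \<mu> * fm p) * ext_d gm p v) \<and>
           \<omega> 4 1 p v = 1 / 2 * (exp (\<mu> * fp p) * ext_d gp p v - exp (- \<mu> * fm p) * ext_d gm p v) \<and>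
           \<omega> 4 3 p v = \<mu> / 2 * (exp (\<mu> * fp p) * ext_d gp p v - exp (- \<mu> * fm p) * ext_d gm p v))))"
    (is "?a \<longleftrightarrow> ?b")
proof -
  interpret flat_neutral_frame E \<A> h D e \<omega>
    by standard (fact assms)+
  note light_like = fully_light_like_iff[OF assms(7,8,10)]
  show ?thesis
  proof
    assume ?a
    then have sq: "(\<theta>\<^sub>1 \<epsilon> p v)\<^sup>2 = (\<theta>\<^sub>2 \<epsilon> p v)\<^sup>2" and nz: "\<exists>v. \<theta>\<^sub>1 \<epsilon> p v \<noteq> 0"
      if "\<epsilon> \<in> {1, -1}" for \<epsilon> p v
      using that light_like by auto
    have sign: "(1::real) \<in> {1, -1}" "(-1::real) \<in> {1, -1}"
      by auto
    obtain \<mu> fp gp where plus: "\<mu> \<in> {1, -1}" "smooth_on UNIV fp" "smooth_on UNIV gp"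
      "\<And>p. ext_d gp p \<noteq> (\<lambda>_. 0)"
      "\<And>p v. \<phi> 1 p v = ext_d fp p v" "\<And>p v. \<theta>\<^sub>1 1 p v = exp (\<mu> * fp p) * ext_d gp p v"
      "\<And>p v. \<theta>\<^sub>2 1 p v = \<mu> * (exp (\<mu> * fp p) * ext_d gp p v)"
      by (rule fully_light_like_potentials[OF sign(1) sq[OF sign(1)] nz[OF sign(1)]]) blast
    obtain \<nu> fm gm where minus: "\<nu> \<in> {1, -1}" "smooth_on UNIV fm" "smooth_on UNIV gm"
      "\<And>p. ext_d gm p \<noteq> (\<lambda>_. 0)"
      "\<And>p v. \<phi> (-1) p v = ext_d fm p v" "\<And>p v. \<theta>\<^sub>1 (-1) p v = exp (\<nu> * fm p) * ext_d gm p v"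
      "\<And>p v. \<theta>\<^sub>2 (-1) p v = \<nu> * (exp (\<nu> * fm p) * ext_d gm p v)"
      by (rule fully_light_like_potentials[OF sign(2) sq[OF sign(2)] nz[OF sign(2)]]) blast
    \<comment> \<open>Half sums and half differences over the two signs \<epsilon> invert the
      passage from the connection form to the forms \<phi>, \<open>\<theta>\<^sub>1\<close>,
      \<open>\<theta>\<^sub>2\<close>.\<close>
    have \<omega>: "\<omega> 3 1 p v = 1 / 2 * (\<phi> 1 p v - \<phi> (-1) p v)" "\<omega> 4 2 p v = - (1 / 2) * (\<phi> 1 p v + \<phi> (-1) p v)"
      "\<omega> 3 2 p v = 1 / 2 * (\<theta>\<^sub>1 1 p v + \<theta>\<^sub>1 (-1) p v)" "\<omega> 4 1 p v = 1 / 2 * (\<theta>\<^sub>1 1 p v - \<theta>\<^sub>1 (-1) p v)"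
      "\<omega> 4 3 p v = 1 / 2 * (\<theta>\<^sub>2 1 p v + \<theta>\<^sub>2 (-1) p v)" "\<omega> 2 1 p v = 1 / 2 * (\<theta>\<^sub>2 1 p v - \<theta>\<^sub>2 (-1) p v)"
      for p v
      by (simp_all add: \<phi>_def \<theta>\<^sub>1_def \<theta>\<^sub>2_def)
    have "\<nu> = \<mu> \<or> \<nu> = - \<mu>"
      using plus(1) minus(1) by auto
    then show ?b
    proof
      assume \<nu>: "\<nu> = \<mu>"
      show ?b
        by (rule exI[of _ fp], rule exI[of _ fm], rule exI[of _ gp], rule exI[of _ gm],
            rule bexI[of _ \<mu>], intro conjI allI disjI1 plus(1-4) minus(2-4))
          (use plus(1) in \<open>simp_all add: \<omega> plus(5-7) minus(5-7) \<nu> right_diff_distrib distrib_left\<close>)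
    next
      assume \<nu>: "\<nu> = - \<mu>"
      show ?b
        by (rule exI[of _ fp], rule exI[of _ fm], rule exI[of _ gp], rule exI[of _ gm],
            rule bexI[of _ \<mu>], intro conjI allI disjI2 plus(1-4) minus(2-4))
          (use plus(1) in \<open>simp_all add: \<omega> plus(5-7) minus(5-7) \<nu> right_diff_distrib distrib_left\<close>)
    qed
  next
    assume ?b
    then obtain fp fm gp gm \<mu> where b: "\<mu> \<in> {1, -1}" "\<And>p. ext_d gp p \<noteq> (\<lambda>_. 0)" "\<And>p. ext_d gm p \<noteq> (\<lambda>_. 0)"
      and cases: "(\<forall>p v.
           \<omega> 2 1 p v = \<mu> / 2 * (exp (\<mu> * fp p) * ext_d gp p v - exp (\<mu> * fm p) * ext_d gm p v) \<and>
           \<omega> 3 2 p v = 1 / 2 * (exp (\<mu> * fp p) * ext_d gp p v + exp (\<mu> * fm p) * ext_d gm p v) \<and>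
           \<omega> 4 1 p v = 1 / 2 * (exp (\<mu> * fp p) * ext_d gp p v - exp (\<mu> * fm p) * ext_d gm p v) \<and>
           \<omega> 4 3 p v = \<mu> / 2 * (exp (\<mu> * fp p) * ext_d gp p v + exp (\<mu> * fm p) * ext_d gm p v))
        \<or>
        (\<forall>p v.
           \<omega> 2 1 p v = \<mu> / 2 * (exp (\<mu> * fp p) * ext_d gp p v + exp (- \<mu> * fm p) * ext_d gm p v) \<and>
           \<omega> 3 2 p v = 1 / 2 * (exp (\<mu> * fp p) * ext_d gp p v + exp (- \<mu> * fm p) * ext_d gm p v) \<and>
           \<omega> 4 1 p v = 1 / 2 * (exp (\<mu> * fp p) * ext_d gp p v - exp (- \<mu> * fm p) * ext_d gm p v) \<and>
           \<omega> 4 3 p v = \<mu> / 2 * (exp (\<mu> * fp p) * ext_d gp p v - exp (- \<mu> * fm p) * ext_d gm p v))"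
        (is "?A \<or> ?B")
      by blast
    \<comment> \<open>A second sign for \<epsilon> = -1 puts both alternatives into one shape: \<nu>
      is \<mu> in the first and - \<mu> in the second.\<close>
    have "\<exists>\<nu>\<in>{1, -1}. \<forall>p v. \<theta>\<^sub>1 1 p v = exp (\<mu> * fp p) * ext_d gp p v
        \<and> \<theta>\<^sub>2 1 p v = \<mu> * (exp (\<mu> * fp p) * ext_d gp p v)
        \<and> \<theta>\<^sub>1 (-1) p v = exp (\<nu> * fm p) * ext_d gm p v
        \<and> \<theta>\<^sub>2 (-1) p v = \<nu> * (exp (\<nu> * fm p) * ext_d gm p v)"
      using cases
    proof
      assume ?A
      then show ?thesis
        using b(1) by (intro bexI[of _ \<mu>])
          (simp_all add: \<theta>\<^sub>1_def \<theta>\<^sub>2_def right_diff_distrib distrib_left)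
    next
      assume ?B
      then show ?thesis
        using b(1) by (intro bexI[of _ "- \<mu>"])
          (auto simp: \<theta>\<^sub>1_def \<theta>\<^sub>2_def right_diff_distrib distrib_left)
    qed
    then obtain \<nu> where \<nu>: "\<nu> \<in> {1, -1}"
      and \<theta>: "\<And>p v. \<theta>\<^sub>1 1 p v = exp (\<mu> * fp p) * ext_d gp p v"
        "\<And>p v. \<theta>\<^sub>2 1 p v = \<mu> * (exp (\<mu> * fp p) * ext_d gp p v)"
        "\<And>p v. \<theta>\<^sub>1 (-1) p v = exp (\<nu> * fm p) * ext_d gm p v"
        "\<And>p v. \<theta>\<^sub>2 (-1) p v = \<nu> * (exp (\<nu> * fm p) * ext_d gm p v)"
      by blast
    have "\<exists>v. ext_d gp p v \<noteq> 0" "\<exists>v. ext_d gm p v \<noteq> 0" for p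
      using b(2,3)[of p] by (auto simp: fun_eq_iff)
    \<comment> \<open>The squared signs give equal squares of \<open>\<theta>\<^sub>1\<close> and
      \<open>\<theta>\<^sub>2\<close>; as the exponential has no zeros,
      \<open>\<theta>\<^sub>1\<close> is nonzero wherever dg is.\<close>
    moreover have "\<mu>\<^sup>2 = 1" "\<nu>\<^sup>2 = 1"
      using b(1) \<nu> by auto
    ultimately show ?a
      by (simp add: light_like \<theta> power_mult_distrib)
  qed
qed

end
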